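(* The curve $p\mapsto(p+c(p),c(p))$, $p\ge0$, is strictly decreasing, in the sense that $0\le p_1<p_2$ implies $p_1+c(p_1)<p_2+c(p_2)$ and $c(p_1)>c(p_2)$.
   Context: Let $s\in(0,1)$, $n>2s$, and let $\Omega\subset\mathbb R^n$ be a bounded domain with Lipschitz boundary. Let $K:\mathbb R^n\setminus\{0\}\to(0,\infty)$ satisfy: (i) $mK\in L^1(\mathbb R^n)$ with $m(x)=\min\{|x|^2,1\}$; (ii) there is $\lambda>0$ with $K(x)\ge\lambda|x|^{-(n+2s)}$ for all $x\ne0$; (iii) $K(x)=K(-x)$. Put $Q=\mathbb R^{2n}\setminus((\mathbb R^n\setminus\Omega)\times(\mathbb R^n\setminus\Omega))$. Let $X$ be the space of measurable $u:\mathbb R^n\to\mathbb R$ with $u|_\Omega\in L^2(\Omega)$ and $(u(x)-u(y))\sqrt{K(x-y)}\in L^2(Q)$, and let $X_0=\{u\in X: u=0 \text{ a.e. in }\mathbb R^n\setminus\Omega\}$, a Hilbert space with norm $\|u\|_{X_0}=\left(\int_Q|u(x)-u(y)|^2K(x-y)\,dx\,dy\right)^{1/2}$. Write $u^+=\max(u,0)$. $\lambda_1=\inf\{\|u\|_{X_0}^2: u\in X_0,\ \int_\Omega u^2=1\}$ is a simple eigenvalue, attained by functions of constant sign; $\phi_1$ denotes the nonnegative minimizer with $\int_\Omega\phi_1^2=1$. Let $\mathcal P=\{u\in X_0:\int_\Omega u^2\,dx=1\}$ with the topology of $X_0$, and for $p\ge0$ let $J_p(u)=\|u\|_{X_0}^2-p\int_\Omega(u^+)^2\,dx$,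 $\Gamma=\{\gamma\in C([-1,1],\mathcal P):\gamma(-1)=-\phi_1,\ \gamma(1)=\phi_1\}$, and $c(p)=\inf_{\gamma\in\Gamma}\max_{u\in\gamma([-1,1])}J_p(u)$. *)

theory Defs
  imports "HOL-Analysis.Analysis"
begin

(* Near each boundary point, the set is the strict epigraph of a Lipschitz function g in the
   direction of a unit vector e. The base of the graph is the hyperplane orthogonal to e, and
   y - (y \<bullet> e) *\<^sub>R e is the projection of y to it, so no choice of rotated coordinates is needed. *)
definition lipschitz_boundary :: "'a::euclidean_space set \<Rightarrow> bool" where
  "lipschitz_boundary \<Omega> \<longleftrightarrow>
     (\<forall>x\<in>frontier \<Omega>. \<exists>r>0. \<exists>e g L. norm e = 1 \<and> L-lipschitz_on {z. z \<bullet> e = 0} g \<and>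
        \<Omega> \<inter> ball x r = {y \<in> ball x r. y \<bullet> e > g (y - (y \<bullet> e) *\<^sub>R e)})"

definition lipschitz_domain :: "'a::euclidean_space set \<Rightarrow> bool" where
  "lipschitz_domain \<Omega> \<longleftrightarrow>
     open \<Omega> \<and> connected \<Omega> \<and> \<Omega> \<noteq> {} \<and> bounded \<Omega> \<and> lipschitz_boundary \<Omega>"

(* K is a function on the punctured space; the value K 0 is arbitrary and is never used
   (the weight vanishes at 0, and the diagonal is a null set in the double integrals).
   Measurability of K is part of the integrability condition. *)
definition admissible_kernel :: "real \<Rightarrow> ((real^'n) \<Rightarrow> real) \<Rightarrow> bool" where
  "admissible_kernel s K \<longleftrightarrow>
     (\<forall>x. x \<noteq> 0 \<longrightarrow> K x > 0) \<and>
     integrable lebesgue (\<lambda>x. min ((norm x)\<^sup>2) 1 * K x) \<and>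
     (\<exists>c>0. \<forall>x. x \<noteq> 0 \<longrightarrow> K x \<ge> c * norm x powr (- (real CARD('n) + 2 * s))) \<and>
     (\<forall>x. x \<noteq> 0 \<longrightarrow> K x = K (- x))"

definition square_integrable_on :: "('a::euclidean_space \<Rightarrow> real) \<Rightarrow> 'a set \<Rightarrow> bool" where
  "square_integrable_on f A \<longleftrightarrow>
     set_borel_measurable lebesgue A f \<and> set_integrable lebesgue A (\<lambda>x. (f x)\<^sup>2)"

definition Qset :: "(real^'n) set \<Rightarrow> ((real^'n) \<times> (real^'n)) set" where
  "Qset \<Omega> = UNIV - (- \<Omega>) \<times> (- \<Omega>)"

(* The spaces X and X_0 consist of representatives: functions that agree almost everywhere are
   not identified. Hence pointwise identities between elements are stated almost everywhere. *)
definition Xspace :: "((real^'n) \<Rightarrow> real) \<Rightarrow> (real^'n) set \<Rightarrow> ((real^'n) \<Rightarrow> real) set" where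
  "Xspace K \<Omega> = {u. u \<in> borel_measurable lebesgue \<and> square_integrable_on u \<Omega> \<and>
     square_integrable_on (\<lambda>(x, y). (u x - u y) * sqrt (K (x - y))) (Qset \<Omega>)}"

definition X0 :: "((real^'n) \<Rightarrow> real) \<Rightarrow> (real^'n) set \<Rightarrow> ((real^'n) \<Rightarrow> real) set" where
  "X0 K \<Omega> = {u \<in> Xspace K \<Omega>. AE x in lebesgue. x \<notin> \<Omega> \<longrightarrow> u x = 0}"

definition X0_norm :: "((real^'n) \<Rightarrow> real) \<Rightarrow> (real^'n) set \<Rightarrow> ((real^'n) \<Rightarrow> real) \<Rightarrow> real" where
  "X0_norm K \<Omega> u =
     sqrt (set_lebesgue_integral lebesgue (Qset \<Omega>) (\<lambda>(x, y). \<bar>u x - u y\<bar>\<^sup>2 * K (x - y)))"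

definition Psphere :: "((real^'n) \<Rightarrow> real) \<Rightarrow> (real^'n) set \<Rightarrow> ((real^'n) \<Rightarrow> real) set" where
  "Psphere K \<Omega> = {u \<in> X0 K \<Omega>. set_lebesgue_integral lebesgue \<Omega> (\<lambda>x. (u x)\<^sup>2) = 1}"

definition lambda1 :: "((real^'n) \<Rightarrow> real) \<Rightarrow> (real^'n) set \<Rightarrow> real" where
  "lambda1 K \<Omega> = (INF u\<in>Psphere K \<Omega>. (X0_norm K \<Omega> u)\<^sup>2)"

definition nonneg_minimizer ::
    "((real^'n) \<Rightarrow> real) \<Rightarrow> (real^'n) set \<Rightarrow> ((real^'n) \<Rightarrow> real) \<Rightarrow> bool" where
  "nonneg_minimizer K \<Omega> \<phi> \<longleftrightarrow>
     \<phi> \<in> Psphere K \<Omega> \<and> (X0_norm K \<Omega> \<phi>)\<^sup>2 = lambda1 K \<Omega> \<and> (AE x in lebesgue. \<phi> x \<ge> 0)"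

definition Jfun ::
    "((real^'n) \<Rightarrow> real) \<Rightarrow> (real^'n) set \<Rightarrow> real \<Rightarrow> ((real^'n) \<Rightarrow> real) \<Rightarrow> real" where
  "Jfun K \<Omega> p u =
     (X0_norm K \<Omega> u)\<^sup>2 - p * set_lebesgue_integral lebesgue \<Omega> (\<lambda>x. (max (u x) 0)\<^sup>2)"

(* Continuity into the sphere with the topology of X_0, i.e. with respect to X0_norm;
   only the values of the path on {-1..1} matter. *)
definition Gamma_paths :: "((real^'n) \<Rightarrow> real) \<Rightarrow> (real^'n) set \<Rightarrow> ((real^'n) \<Rightarrow> real)
    \<Rightarrow> (real \<Rightarrow> (real^'n) \<Rightarrow> real) set" where
  "Gamma_paths K \<Omega> \<phi> = {\<gamma>. (\<forall>t\<in>{-1..1}. \<gamma> t \<in> Psphere K \<Omega>) \<and>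
     (\<forall>t\<in>{-1..1}. ((\<lambda>t'. X0_norm K \<Omega> (\<lambda>x. \<gamma> t' x - \<gamma> t x)) \<longlongrightarrow> 0) (at t within {-1..1})) \<and>
     (AE x in lebesgue. \<gamma> (-1) x = - \<phi> x) \<and> (AE x in lebesgue. \<gamma> 1 x = \<phi> x)}"

(* The supremum is a maximum: the functional is continuous on the compact image of the path. *)
definition minimax_level ::
    "((real^'n) \<Rightarrow> real) \<Rightarrow> (real^'n) set \<Rightarrow> ((real^'n) \<Rightarrow> real) \<Rightarrow> real \<Rightarrow> real" where
  "minimax_level K \<Omega> \<phi> p = (INF \<gamma>\<in>Gamma_paths K \<Omega> \<phi>. SUP u\<in>\<gamma> ` {-1..1}. Jfun K \<Omega> p u)"

end

theory Submission
  imports Defs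
begin

text \<open>
The proof replaces the minimax over paths by a minimisation over pairs of functions, for which the
dependence on $p$ is explicit.

Call $(f,g)$ a nodal pair if $f,g\ge0$ lie in $X_0$, have disjoint supports and unit $L^2$ norm. Put
$A=\|f\|^2$, $B=\|g\|^2$ and $D=-\langle f,g\rangle\ge0$. On the arc of all $\alpha f-\beta g$ with
$\alpha,\beta\ge0$ and $\alpha^2+\beta^2=1$, the functional $J_p$ is the quadratic form of the matrix
with rows $(A-p,D)$ and $(D,B)$; let $\mu_p(f,g)$ be its largest eigenvalue. Then $c(p)$ is the
infimum of $\mu_p$ over nodal pairs:

\<^item> A nodal pair yields a path on which $J_p\le\mu_p(f,g)$ (\<open>nodal_path_below\<close>). The arc
  joins $-g$ to $f$, and the curves $\sqrt{(1-t)f^2+t\phi_1^2}$ and $-\sqrt{(1-t)g^2+t\phi_1^2}$ lead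
  from there to $\phi_1$ and $-\phi_1$. The energy is convex along such curves (hidden convexity) and
  smallest at $\pm\phi_1$, so $J_p$ does not exceed its value at $f$ or $-g$.

\<^item> A path with $J_p<m$ throughout contains a sign-changing $u$ whose normalised positive and
  negative parts satisfy $\mu_p\le m$ (\<open>nodal_pair_below_path\<close>). For
  $v=(\|u^+\|_2,\|u^-\|_2)$ and the matrix $M$ of these parts, $J_p(u)=v\cdot Mv$. The inequality
  $v\cdot Mv<m|v|^2$ holds all along the path; the intermediate value theorem finds a point at
  which it splits into the two componentwise inequalities $Mv<mv$, and these bound the largest
  eigenvalue because $M$ has nonnegative off-diagonal entries and $v>0$. The continuity that is
  needed is that of $u\mapsto\langle u,u^+\rangle$.

Raising $p$ by $\delta$ lowers $\mu_p$ by at most $\delta$ and by at least $0$; both bounds are strict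
as soon as $D>0$, since the eigenvector then has two nonzero components. To pass to the infimum,
strictness must be uniform. The kernel is bounded below on bounded sets, so $D$ is at least a
constant times $\|f\|_1\|g\|_1$, and a Nash-type inequality bounds the $L^1$ norms from below in
terms of the energy alone (\<open>coupling_lower_bound\<close>). Hence $D$ is bounded away from zero
along every minimising sequence, and so is the strict change of $\mu_p$
(\<open>top_eigenvalue_le_improves\<close>).
\<close>

section \<open>Null sets and integrals on a product\<close>

text \<open>
By Fubini, a Borel null set has a null preimage under a Borel map \<open>T\<close> on the product as soon
as almost every section of the preimage is null.
\<close>

lemma AE_lebesgue_compose:
  fixes T :: "'a::euclidean_space \<times> 'a \<Rightarrow> 'a"
  assumes T[measurable]: "T \<in> borel_measurable borel"
    and null: "\<And>N. N \<in> null_sets lborel \<Longrightarrow> AE x in lborel. AE y in lborel. T (x, y) \<notin> N"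
    and P: "AE x in lebesgue. P x"
  shows "AE z in lebesgue. P (T z)"
proof -
  have "AE x in lborel. P x"
    using P by (simp add: AE_completion_iff)
  then obtain N where N: "N \<in> null_sets lborel" "{x. \<not> P x} \<subseteq> N"
    by (auto simp: eventually_ae_filter)
  have [measurable]: "N \<in> sets borel"
    using N(1) by (auto simp: null_sets_def)
  have [measurable]: "T \<in> borel_measurable (lborel \<Otimes>\<^sub>M lborel)"
    using T by (simp add: lborel_prod)
  have "AE z in lborel \<Otimes>\<^sub>M lborel. T z \<notin> N"
    by (rule lborel_pair.AE_pair_measure) (use null[OF N(1)] in measurable)
  then have "AE z in lborel. T z \<notin> N"
    unfolding lborel_prod .
  then show ?thesis
    using N(2) by (auto simp: AE_completion_iff elim: eventually_mono)
qed

text \<open>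
Composition with a Borel map does not preserve Lebesgue measurability in general. It does so
when null sets pull back to null sets, since the function may then be exchanged for a Borel one.
\<close>

lemma measurable_lebesgue_compose:
  fixes T :: "'a::euclidean_space \<times> 'a \<Rightarrow> 'a" and f :: "'a \<Rightarrow> real"
  assumes T[measurable]: "T \<in> borel_measurable borel"
    and null: "\<And>N. N \<in> null_sets lborel \<Longrightarrow> AE x in lborel. AE y in lborel. T (x, y) \<notin> N"
    and f: "f \<in> borel_measurable lebesgue"
  shows "(\<lambda>z. f (T z)) \<in> borel_measurable lebesgue"
proof -
  obtain g where g[measurable]: "g \<in> borel_measurable lborel" and "AE x in lborel. f x = g x"
    using completion_ex_borel_measurable_real[OF f] by auto
  then have "AE x in lebesgue. g x = f x"
    by (simp add: AE_completion_iff eq_commute)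
  from AE_lebesgue_compose[OF T null this] have "AE z in lebesgue. g (T z) = f (T z)" .
  moreover have "(\<lambda>z. g (T z)) \<in> borel_measurable lebesgue"
    by (intro measurable_completion) (use g T in measurable)
  ultimately show ?thesis
    by (rule borel_measurable_AE[rotated])
qed

lemma null_fst: "N \<in> null_sets lborel \<Longrightarrow> AE x in lborel. AE y in lborel. fst (x, y :: 'a::euclidean_space) \<notin> N"
  by (auto dest: AE_not_in)

lemma null_snd: "N \<in> null_sets lborel \<Longrightarrow> AE x in lborel. AE y in lborel. snd (x :: 'a::euclidean_space, y) \<notin> N"
  by (auto dest: AE_not_in)

lemma nn_integral_lborel_reflect:
  fixes h :: "'a::euclidean_space \<Rightarrow> ennreal"
  assumes [measurable]: "h \<in> borel_measurable borel"
  shows "(\<integral>\<^sup>+y. h (x - y) \<partial>lborel) = (\<integral>\<^sup>+y. h y \<partial>lborel)"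
proof -
  have "(\<integral>\<^sup>+y. h y \<partial>lborel) = (\<integral>\<^sup>+y. h y \<partial>(density (distr lborel borel (\<lambda>y. x + (-1) *\<^sub>R y)) (\<lambda>_. \<bar>-1::real\<bar>^DIM('a))))"
    using lborel_affine[of "-1" x] by simp
  also have "\<dots> = (\<integral>\<^sup>+y. h (x - y) \<partial>lborel)"
    by (simp add: density_1 nn_integral_distr)
  finally show ?thesis by simp
qed

text \<open>
Each section \<open>y \<mapsto> x - y\<close> preserves Lebesgue measure.
\<close>

lemma null_diff:
  assumes N: "N \<in> null_sets lborel"
  shows "AE x in lborel. AE y in lborel. fst (x, y) - snd (x, y :: 'a::euclidean_space) \<notin> N"
proof (rule AE_I2)
  fix x :: 'a
  have [measurable]: "N \<in> sets borel"
    using N by (auto simp: null_sets_def)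
  have "(\<integral>\<^sup>+y. indicator N (x - y) \<partial>lborel) = 0"
    using N by (subst nn_integral_lborel_reflect) (auto simp: null_sets_def)
  then have "AE y in lborel. indicator N (x - y) = (0::ennreal)"
    by (subst (asm) nn_integral_0_iff_AE) auto
  then show "AE y in lborel. fst (x, y) - snd (x, y) \<notin> N"
    by (auto elim: eventually_mono simp: indicator_def split: if_splits)
qed

lemma AE_lebesgue_fst:
  fixes P :: "'a::euclidean_space \<Rightarrow> bool"
  assumes "AE x in lebesgue. P x"
  shows "AE z::'a \<times> 'a in lebesgue. P (fst z)"
proof (rule AE_lebesgue_compose[where T="\<lambda>z. fst z", OF _ _ assms])
  show "(\<lambda>z::'a \<times> 'a. fst z) \<in> borel_measurable borel"
    by (intro borel_measurable_continuous_onI continuous_intros)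
qed (rule null_fst)

lemma measurable_lebesgue_fst:
  fixes f :: "'a::euclidean_space \<Rightarrow> real"
  assumes "f \<in> borel_measurable lebesgue"
  shows "(\<lambda>z::'a \<times> 'a. f (fst z)) \<in> borel_measurable lebesgue"
proof (rule measurable_lebesgue_compose[where T="\<lambda>z. fst z", OF _ _ assms])
  show "(\<lambda>z::'a \<times> 'a. fst z) \<in> borel_measurable borel"
    by (intro borel_measurable_continuous_onI continuous_intros)
qed (rule null_fst)

lemma AE_lebesgue_snd:
  fixes P :: "'a::euclidean_space \<Rightarrow> bool"
  assumes "AE x in lebesgue. P x"
  shows "AE z::'a \<times> 'a in lebesgue. P (snd z)"
proof (rule AE_lebesgue_compose[where T="\<lambda>z. snd z", OF _ _ assms])
  show "(\<lambda>z::'a \<times> 'a. snd z) \<in> borel_measurable borel"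
    by (intro borel_measurable_continuous_onI continuous_intros)
qed (rule null_snd)

lemma measurable_lebesgue_snd:
  fixes f :: "'a::euclidean_space \<Rightarrow> real"
  assumes "f \<in> borel_measurable lebesgue"
  shows "(\<lambda>z::'a \<times> 'a. f (snd z)) \<in> borel_measurable lebesgue"
proof (rule measurable_lebesgue_compose[where T="\<lambda>z. snd z", OF _ _ assms])
  show "(\<lambda>z::'a \<times> 'a. snd z) \<in> borel_measurable borel"
    by (intro borel_measurable_continuous_onI continuous_intros)
qed (rule null_snd)

lemma AE_lebesgue_diff:
  fixes P :: "'a::euclidean_space \<Rightarrow> bool"
  assumes "AE x in lebesgue. P x"
  shows "AE z::'a \<times> 'a in lebesgue. P (fst z - snd z)"
proof (rule AE_lebesgue_compose[where T="\<lambda>z. fst z - snd z", OF _ _ assms])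
  show "(\<lambda>z::'a \<times> 'a. fst z - snd z) \<in> borel_measurable borel"
    by (intro borel_measurable_continuous_onI continuous_intros)
qed (rule null_diff)

lemma measurable_lebesgue_diff:
  fixes f :: "'a::euclidean_space \<Rightarrow> real"
  assumes "f \<in> borel_measurable lebesgue"
  shows "(\<lambda>z::'a \<times> 'a. f (fst z - snd z)) \<in> borel_measurable lebesgue"
proof (rule measurable_lebesgue_compose[where T="\<lambda>z. fst z - snd z", OF _ _ assms])
  show "(\<lambda>z::'a \<times> 'a. fst z - snd z) \<in> borel_measurable borel"
    by (intro borel_measurable_continuous_onI continuous_intros)
qed (rule null_diff)

lemma nn_integral_lborel_product:
  fixes f g :: "'a::euclidean_space \<Rightarrow> ennreal"
  assumes [measurable]: "f \<in> borel_measurable borel" "g \<in> borel_measurable borel"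
  shows "(\<integral>\<^sup>+z. f (fst z) * g (snd z) \<partial>lborel) = (\<integral>\<^sup>+x. f x \<partial>lborel) * (\<integral>\<^sup>+y. g y \<partial>lborel)"
  unfolding lborel_prod[symmetric]
  by (subst lborel.nn_integral_fst[symmetric]) (auto simp: nn_integral_cmult nn_integral_multc)

lemma nn_integral_lborel_translate:
  fixes h :: "'a::euclidean_space \<Rightarrow> ennreal"
  assumes [measurable]: "h \<in> borel_measurable borel"
  shows "(\<integral>\<^sup>+x. h (x - y) \<partial>lborel) = (\<integral>\<^sup>+x. h x \<partial>lborel)"
  using nn_integral_lborel_reflect[of "\<lambda>x. h (- x)" y] nn_integral_lborel_reflect[of h 0] by simp

lemma nn_integral_lborel_cong_lebesgue:
  assumes "AE x in lebesgue. f x = g x"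
  shows "(\<integral>\<^sup>+x. f x \<partial>lborel) = (\<integral>\<^sup>+x. g x \<partial>lebesgue)"
  using assms unfolding nn_integral_completion AE_completion_iff by (rule nn_integral_cong_AE)

section \<open>Limits of integrals\<close>

text \<open>
Dominated convergence with a dominating function that varies, up to an error that vanishes in
$L^1$. The truncations \<open>min (G n) h\<close> have an integrable majorant, and what they cut off is at
most \<open>e n\<close>.
\<close>

lemma tendsto_integral_of_dominated_L1:
  fixes G :: "nat \<Rightarrow> 'a \<Rightarrow> real"
  assumes [measurable]: "\<And>n. G n \<in> borel_measurable M" "G' \<in> borel_measurable M"
    and h: "integrable M h" and e: "\<And>n. integrable M (e n)"
    and lim_e: "(\<lambda>n. \<integral>x. e n x \<partial>M) \<longlonglongrightarrow> 0"
    and nonneg: "\<And>n x. 0 \<le> G n x" "\<And>x. 0 \<le> h x" "\<And>n x. 0 \<le> e n x"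
    and bound: "\<And>n x. G n x \<le> h x + e n x"
    and lim: "AE x in M. (\<lambda>n. G n x) \<longlonglongrightarrow> G' x"
    and lim_bound: "AE x in M. G' x \<le> h x"
  shows "(\<lambda>n. \<integral>x. G n x \<partial>M) \<longlonglongrightarrow> (\<integral>x. G' x \<partial>M)"
proof -
  have [measurable]: "h \<in> borel_measurable M" "\<And>n. e n \<in> borel_measurable M"
    using h e by auto
  have I: "integrable M (\<lambda>x. min (G n x) (h x))" for n
    by (rule Bochner_Integration.integrable_bound[OF h]) (use nonneg in \<open>auto simp: min_def\<close>)
  have I': "integrable M (G n)" for n
    by (rule Bochner_Integration.integrable_bound[OF Bochner_Integration.integrable_add[OF h e[of n]]])
       (use nonneg bound in \<open>auto intro!: AE_I2 order_trans[OF _ abs_ge_self]\<close>)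
  have a: "(\<lambda>n. \<integral>x. min (G n x) (h x) \<partial>M) \<longlonglongrightarrow> (\<integral>x. G' x \<partial>M)"
  proof (rule integral_dominated_convergence[where w=h])
    show "AE x in M. (\<lambda>n. min (G n x) (h x)) \<longlonglongrightarrow> G' x"
      using lim lim_bound
    proof eventually_elim
      case (elim x)
      have "(\<lambda>n. min (G n x) (h x)) \<longlonglongrightarrow> min (G' x) (h x)"
        by (intro tendsto_intros elim)
      with elim show ?case by (simp add: min_def)
    qed
  qed (use nonneg h in \<open>auto simp: min_def\<close>)
  have b: "(\<lambda>n. (\<integral>x. G n x \<partial>M) - (\<integral>x. min (G n x) (h x) \<partial>M)) \<longlonglongrightarrow> 0"
  proof (rule tendsto_sandwich[OF _ _ tendsto_const lim_e]; intro always_eventually allI)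
    fix n
    have eq: "(\<integral>x. G n x \<partial>M) - (\<integral>x. min (G n x) (h x) \<partial>M) = (\<integral>x. G n x - min (G n x) (h x) \<partial>M)"
      using I I' by simp
    show "0 \<le> (\<integral>x. G n x \<partial>M) - (\<integral>x. min (G n x) (h x) \<partial>M)"
      unfolding eq by (rule integral_nonneg_AE) auto
    show "(\<integral>x. G n x \<partial>M) - (\<integral>x. min (G n x) (h x) \<partial>M) \<le> (\<integral>x. e n x \<partial>M)"
      unfolding eq
      by (rule integral_mono[OF Bochner_Integration.integrable_diff[OF I' I] e])
         (use bound nonneg in \<open>auto simp: min_def algebra_simps\<close>)
  qed
  show ?thesis
    using tendsto_add[OF a b] by simp
qed

text \<open>
This turns almost everywhere convergence along subsequences, which is all that norm convergence
gives, into convergence of the integrals along the whole sequence.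
\<close>

lemma convergent_subsubsequences_imp_tendsto:
  fixes X :: "nat \<Rightarrow> 'a::metric_space"
  assumes "\<And>r :: nat \<Rightarrow> nat. strict_mono r \<Longrightarrow> \<exists>q :: nat \<Rightarrow> nat. (\<lambda>n. X (r (q n))) \<longlonglongrightarrow> L"
  shows "X \<longlonglongrightarrow> L"
proof (rule ccontr)
  assume "\<not> X \<longlonglongrightarrow> L"
  then obtain e where e: "0 < e" "\<not> (\<forall>\<^sub>F n in sequentially. dist (X n) L < e)"
    by (auto simp: tendsto_iff)
  then obtain r :: "nat \<Rightarrow> nat" where r: "strict_mono r" "\<And>n. \<not> dist (X (r n)) L < e"
    using not_eventually_sequentiallyD by blast
  then obtain q where "(\<lambda>n. X (r (q n))) \<longlonglongrightarrow> L"
    using assms by blast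
  then have "\<forall>\<^sub>F n in sequentially. dist (X (r (q n))) L < e"
    using e(1) by (rule tendstoD)
  then show False
    using r(2) by (auto dest: eventually_happens)
qed

section \<open>Increments and pointwise inequalities\<close>

definition increment :: "('a \<Rightarrow> real) \<Rightarrow> 'a \<times> 'a \<Rightarrow> real" where
  "increment u z = u (fst z) - u (snd z)"

lemma borel_measurable_increment:
  fixes u :: "'a::euclidean_space \<Rightarrow> real"
  assumes "u \<in> borel_measurable lebesgue"
  shows "increment u \<in> borel_measurable lebesgue"
  unfolding increment_def
  by (intro borel_measurable_diff measurable_lebesgue_fst measurable_lebesgue_snd assms)

lemma AE_increment:
  fixes u v :: "'a::euclidean_space \<Rightarrow> real"
  assumes "AE x in lebesgue. u x = v x"
  shows "AE z in lebesgue. increment u z = increment v z"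
  using AE_lebesgue_fst[OF assms] AE_lebesgue_snd[OF assms]
  by eventually_elim (simp add: increment_def)

lemma square_sum_le: "(a + b)\<^sup>2 \<le> 2 * a\<^sup>2 + 2 * (b::real)\<^sup>2"
  using zero_le_power2[of "a - b"] by (simp add: power2_eq_square algebra_simps)

text \<open>
For disjoint nonnegative functions the two increments never have the same strict sign; this is
the source of the sign of their interaction energy, and of its explicit lower bound.
\<close>

lemma increment_mult_disjoint:
  assumes "\<And>x. f x * g x = (0::real)"
  shows "- (increment f z * increment g z) = f (fst z) * g (snd z) + f (snd z) * g (fst z)"
  using assms[of "fst z"] assms[of "snd z"] by (auto simp: increment_def)

text \<open>
Hidden convexity: this is the reverse triangle inequality in the plane for the vectors
$(\sqrt\alpha\,a,\sqrt\beta\,b)$ and $(\sqrt\alpha\,c,\sqrt\beta\,d)$.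
\<close>

lemma sqrt_increment_le:
  fixes a b c d :: real
  assumes "0 \<le> \<alpha>" "0 \<le> \<beta>"
  shows "(sqrt (\<alpha> * a\<^sup>2 + \<beta> * b\<^sup>2) - sqrt (\<alpha> * c\<^sup>2 + \<beta> * d\<^sup>2))\<^sup>2 \<le> \<alpha> * (a - c)\<^sup>2 + \<beta> * (b - d)\<^sup>2"
proof -
  define X where "X = \<alpha> * a\<^sup>2 + \<beta> * b\<^sup>2"
  define Y where "Y = \<alpha> * c\<^sup>2 + \<beta> * d\<^sup>2"
  have nonneg: "0 \<le> X" "0 \<le> Y" using assms by (auto simp: X_def Y_def)
  have "X * Y - (\<alpha> * a * c + \<beta> * b * d)\<^sup>2 = \<alpha> * \<beta> * (a * d - b * c)\<^sup>2"
    by (simp add: X_def Y_def power2_eq_square algebra_simps)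
  then have "(\<alpha> * a * c + \<beta> * b * d)\<^sup>2 \<le> X * Y"
    using assms by (metis diff_ge_0_iff_ge mult_nonneg_nonneg zero_le_power2)
  then have 1: "\<alpha> * a * c + \<beta> * b * d \<le> sqrt X * sqrt Y"
    unfolding real_sqrt_mult[symmetric] by (rule real_le_rsqrt)
  have 2: "(sqrt X - sqrt Y)\<^sup>2 = X + Y - 2 * (sqrt X * sqrt Y)"
    using nonneg by (simp add: power2_diff)
  have 3: "\<alpha> * (a - c)\<^sup>2 + \<beta> * (b - d)\<^sup>2 = X + Y - 2 * (\<alpha> * a * c + \<beta> * b * d)"
    by (simp add: X_def Y_def power2_eq_square algebra_simps)
  show ?thesis
    unfolding X_def[symmetric] Y_def[symmetric] 2 3 using 1 by simp
qed

text \<open>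
The symmetric matrix with diagonal \<open>X, Y\<close> and off-diagonal entry \<open>- D\<close> is positive
semidefinite if its diagonal and its determinant are nonnegative.
\<close>

lemma weighted_amgm:
  fixes a b D X Y :: real
  assumes "0 \<le> X" "0 \<le> Y" "D\<^sup>2 \<le> X * Y"
  shows "2 * (a * b) * D \<le> a\<^sup>2 * X + b\<^sup>2 * Y"
proof (rule power2_le_imp_le)
  have "(2 * (a * b) * D)\<^sup>2 = 4 * (a\<^sup>2 * b\<^sup>2) * D\<^sup>2"
    by (simp add: power_mult_distrib)
  also have "\<dots> \<le> 4 * (a\<^sup>2 * b\<^sup>2) * (X * Y)"
    by (rule mult_left_mono[OF assms(3)]) simp
  also have "\<dots> = (a\<^sup>2 * X + b\<^sup>2 * Y)\<^sup>2 - (a\<^sup>2 * X - b\<^sup>2 * Y)\<^sup>2"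
    by (simp add: power2_eq_square algebra_simps)
  also have "\<dots> \<le> (a\<^sup>2 * X + b\<^sup>2 * Y)\<^sup>2"
    by simp
  finally show "(2 * (a * b) * D)\<^sup>2 \<le> (a\<^sup>2 * X + b\<^sup>2 * Y)\<^sup>2" .
qed (use assms in auto)

text \<open>
In the application \<open>x\<close> and \<open>y\<close> are the distances from the diagonal entries of a matrix to
a bound for its eigenvalues, and \<open>x * y\<close> dominates the square of the off-diagonal entry.
Lowering one diagonal entry by \<open>\<delta>\<close> makes room to lower the bound by some \<open>\<epsilon>\<close>. A lower bound
for \<open>x * y\<close> keeps \<open>y\<close> away from zero, which makes \<open>\<epsilon>\<close> independent of the matrix.
\<close>

lemma determinant_gain:
  fixes d X \<delta> :: real
  assumes "0 < d" "0 < X" "0 < \<delta>"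
  shows "\<exists>\<epsilon>>0. \<forall>x y. 0 \<le> x \<longrightarrow> x \<le> X \<longrightarrow> 0 \<le> y \<longrightarrow> y \<le> X \<longrightarrow> d \<le> x * y \<longrightarrow>
      \<epsilon> \<le> \<delta> \<and> \<epsilon> \<le> y \<and> x * y \<le> (x + \<delta> - \<epsilon>) * (y - \<epsilon>)"
proof -
  \<comment> \<open>The factor \<open>d / X\<close> is a lower bound for \<open>y\<close>. The gain \<open>\<delta> * y\<close> in the product must
    compensate the loss, which is at most \<open>\<epsilon> * (2 * X + \<delta>)\<close>.\<close>
  define \<epsilon> where "\<epsilon> = min \<delta> ((d / X) * (\<delta> / (2 * X + \<delta>)))"
  have pos: "0 < \<epsilon>" using assms by (simp add: \<epsilon>_def)
  have "\<epsilon> \<le> \<delta> \<and> \<epsilon> \<le> y \<and> x * y \<le> (x + \<delta> - \<epsilon>) * (y - \<epsilon>)"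
    if xy: "0 \<le> x" "x \<le> X" "0 \<le> y" "y \<le> X" "d \<le> x * y" for x y
  proof (intro conjI)
    show "\<epsilon> \<le> \<delta>" by (simp add: \<epsilon>_def)
    have "d \<le> X * y"
      using xy mult_right_mono[of x X y] by linarith
    then have y: "d / X \<le> y"
      using assms by (simp add: field_simps)
    have \<epsilon>: "\<epsilon> \<le> (d / X) * (\<delta> / (2 * X + \<delta>))"
      by (simp add: \<epsilon>_def)
    also have "\<dots> \<le> (d / X) * 1"
      using assms by (intro mult_left_mono) auto
    finally show "\<epsilon> \<le> y" using y by simp
    have "\<epsilon> * (x + y + \<delta> - \<epsilon>) \<le> \<epsilon> * (2 * X + \<delta>)"
      using xy pos by (intro mult_left_mono) auto
    also have "\<dots> \<le> (d / X) * (\<delta> / (2 * X + \<delta>)) * (2 * X + \<delta>)"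
      using assms \<epsilon> by (intro mult_right_mono) auto
    also have "\<dots> = (d / X) * \<delta>"
      using assms by simp
    also have "\<dots> \<le> y * \<delta>"
      using y assms by (intro mult_right_mono) auto
    finally show "x * y \<le> (x + \<delta> - \<epsilon>) * (y - \<epsilon>)"
      by (simp add: algebra_simps)
  qed
  then show ?thesis
    using pos by blast
qed

section \<open>Paths through a pair of disjoint functions\<close>

text \<open>
The weights of the four functions in \<open>nodal_path\<close>: at time \<open>t\<close> they are \<open>tent_weight t\<close>
for \<open>f\<close>, \<open>tent_weight (- t)\<close> for \<open>g\<close>, \<open>ramp_weight t\<close> for \<open>\<phi>\<close> and \<open>ramp_weight (- t)\<close> for
\<open>- \<phi>\<close>. On $[-1,1]$ they add up to one, and at most two of them are nonzero at a time.
\<close>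

definition tent_weight :: "real \<Rightarrow> real" where
  "tent_weight t = max 0 (min (t + 1 / 2) (2 - 2 * t))"

definition ramp_weight :: "real \<Rightarrow> real" where
  "ramp_weight t = max 0 (2 * t - 1)"

lemma weights_nonneg: "0 \<le> tent_weight t" "0 \<le> ramp_weight t"
  by (auto simp: tent_weight_def ramp_weight_def)

lemma continuous_weights:
  "continuous_on UNIV tent_weight" "continuous_on UNIV ramp_weight"
  unfolding tent_weight_def ramp_weight_def by (intro continuous_intros)+

lemma weights_cases:
  assumes "t \<in> {-1..1}"
  obtains (middle) "ramp_weight t = 0" "ramp_weight (- t) = 0" "tent_weight t + tent_weight (- t) = 1"
  | (right) "tent_weight (- t) = 0" "ramp_weight (- t) = 0" "tent_weight t + ramp_weight t = 1"
  | (left) "tent_weight t = 0" "ramp_weight t = 0" "tent_weight (- t) + ramp_weight (- t) = 1"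
proof -
  consider "\<bar>t\<bar> \<le> 1 / 2" | "1 / 2 < t" | "t < - 1 / 2" by linarith
  then show thesis
  proof cases
    case 1
    then show ?thesis by (intro middle) (auto simp: tent_weight_def ramp_weight_def max_def min_def)
  next
    case 2
    with assms show ?thesis by (intro right) (auto simp: tent_weight_def ramp_weight_def max_def min_def)
  next
    case 3
    with assms show ?thesis by (intro left) (auto simp: tent_weight_def ramp_weight_def max_def min_def)
  qed
qed

text \<open>
The path $-\phi\to-g\to f\to\phi$ as one formula, with breaks at the times $-1/2$ and $1/2$. For
nonnegative functions the middle piece is $\sqrt\alpha f-\sqrt\beta g$ with $\alpha+\beta=1$, and the
outer pieces are the curves of \<open>sqrt_increment_le\<close>.
\<close>

definition nodal_path :: "('a \<Rightarrow> real) \<Rightarrow> ('a \<Rightarrow> real) \<Rightarrow> ('a \<Rightarrow> real) \<Rightarrow> real \<Rightarrow> 'a \<Rightarrow> real" where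
  "nodal_path f g \<phi> t x =
     sqrt (tent_weight t * (f x)\<^sup>2 + ramp_weight t * (\<phi> x)\<^sup>2)
     - sqrt (tent_weight (- t) * (g x)\<^sup>2 + ramp_weight (- t) * (\<phi> x)\<^sup>2)"

lemma sqrt_increment:
  assumes "0 \<le> \<alpha>" "0 \<le> \<beta>"
  shows "(increment (\<lambda>x. sqrt (\<alpha> * (u x)\<^sup>2 + \<beta> * (v x)\<^sup>2)) z)\<^sup>2 \<le> \<alpha> * (increment u z)\<^sup>2 + \<beta> * (increment v z)\<^sup>2"
  unfolding increment_def by (rule sqrt_increment_le[OF assms])

lemma weighted_sum_bound:
  assumes "t \<in> {-1..1}" "0 \<le> a" "0 \<le> b"
  shows "tent_weight t * a + ramp_weight t * b \<le> a + b"
    and "tent_weight (- t) * a + ramp_weight (- t) * b \<le> a + b"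
proof -
  have le1: "tent_weight t \<le> 1" "ramp_weight t \<le> 1" "tent_weight (- t) \<le> 1" "ramp_weight (- t) \<le> 1"
    using assms(1) by (auto simp: tent_weight_def ramp_weight_def max_def min_def)
  show "tent_weight t * a + ramp_weight t * b \<le> a + b"
    by (intro add_mono mult_left_le_one_le assms le1 weights_nonneg)
  show "tent_weight (- t) * a + ramp_weight (- t) * b \<le> a + b"
    by (intro add_mono mult_left_le_one_le assms le1 weights_nonneg)
qed

text \<open>
The bounds do not depend on \<open>t\<close>: they serve as integrable majorants for all points of the path.
\<close>

lemma nodal_path_bounds:
  assumes t: "t \<in> {-1..1}"
  shows "(nodal_path f g \<phi> t x)\<^sup>2 \<le> 2 * ((f x)\<^sup>2 + (\<phi> x)\<^sup>2) + 2 * ((g x)\<^sup>2 + (\<phi> x)\<^sup>2)"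
    and "(increment (nodal_path f g \<phi> t) z)\<^sup>2
      \<le> 2 * ((increment f z)\<^sup>2 + (increment \<phi> z)\<^sup>2) + 2 * ((increment g z)\<^sup>2 + (increment \<phi> z)\<^sup>2)"
proof -
  define P where "P y = sqrt (tent_weight t * (f y)\<^sup>2 + ramp_weight t * (\<phi> y)\<^sup>2)" for y
  define N where "N y = sqrt (tent_weight (- t) * (g y)\<^sup>2 + ramp_weight (- t) * (\<phi> y)\<^sup>2)" for y
  have w: "nodal_path f g \<phi> t y = P y - N y" for y
    by (simp add: nodal_path_def P_def N_def)
  have "(P x)\<^sup>2 \<le> (f x)\<^sup>2 + (\<phi> x)\<^sup>2" "(N x)\<^sup>2 \<le> (g x)\<^sup>2 + (\<phi> x)\<^sup>2"
    using weighted_sum_bound[OF t, of "(f x)\<^sup>2" "(\<phi> x)\<^sup>2"] weighted_sum_bound[OF t, of "(g x)\<^sup>2" "(\<phi> x)\<^sup>2"]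
    by (auto simp: P_def N_def weights_nonneg)
  then show "(nodal_path f g \<phi> t x)\<^sup>2 \<le> 2 * ((f x)\<^sup>2 + (\<phi> x)\<^sup>2) + 2 * ((g x)\<^sup>2 + (\<phi> x)\<^sup>2)"
    using square_sum_le[of "P x" "- N x"] unfolding w by simp
  have "(increment P z)\<^sup>2 \<le> (increment f z)\<^sup>2 + (increment \<phi> z)\<^sup>2"
    unfolding P_def
    using weighted_sum_bound(1)[OF t, of "(increment f z)\<^sup>2" "(increment \<phi> z)\<^sup>2"]
    by (intro order_trans[OF sqrt_increment] weights_nonneg) auto
  moreover have "(increment N z)\<^sup>2 \<le> (increment g z)\<^sup>2 + (increment \<phi> z)\<^sup>2"
    unfolding N_def
    using weighted_sum_bound(2)[OF t, of "(increment g z)\<^sup>2" "(increment \<phi> z)\<^sup>2"]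
    by (intro order_trans[OF sqrt_increment] weights_nonneg) auto
  moreover have "increment (nodal_path f g \<phi> t) z = increment P z + - increment N z"
    by (simp add: increment_def w)
  ultimately show "(increment (nodal_path f g \<phi> t) z)\<^sup>2
      \<le> 2 * ((increment f z)\<^sup>2 + (increment \<phi> z)\<^sup>2) + 2 * ((increment g z)\<^sup>2 + (increment \<phi> z)\<^sup>2)"
    using square_sum_le[of "increment P z" "- increment N z"] by simp
qed

lemma continuous_on_nodal_path: "continuous_on UNIV (\<lambda>t. nodal_path f g \<phi> t x)"
proof -
  have *: "continuous_on UNIV (\<lambda>t. tent_weight (- t))" "continuous_on UNIV (\<lambda>t. ramp_weight (- t))"
    by (rule continuous_on_compose2[OF continuous_weights(1)] continuous_on_compose2[OF continuous_weights(2)];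
        auto intro!: continuous_intros)+
  show ?thesis
    unfolding nodal_path_def by (intro continuous_intros continuous_weights *)
qed

section \<open>The energy space\<close>

locale nonlocal_energy =
  fixes K :: "real^'n \<Rightarrow> real" and \<Omega> :: "(real^'n) set" and s c :: real
  assumes s_pos: "0 < s" and c_pos: "0 < c"
    and kernel: "admissible_kernel s K"
    and kernel_ge: "\<And>x. x \<noteq> 0 \<Longrightarrow> c * norm x powr (- (real CARD('n) + 2 * s)) \<le> K x"
    and open_dom: "open \<Omega>" and dom_nonempty: "\<Omega> \<noteq> {}" and bounded_dom: "bounded \<Omega>"
begin

definition weight :: "(real^'n) \<times> (real^'n) \<Rightarrow> real" where
  "weight z = indicator (Qset \<Omega>) z * \<bar>K (fst z - snd z)\<bar>"

text \<open>
The measure that carries the kernel, so that the energy is the square of the $L^2(\nu)$ norm of the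
increment. The absolute value in \<open>weight\<close> affects the diagonal only, where all increments vanish.
\<close>

definition \<nu> :: "((real^'n) \<times> (real^'n)) measure" where
  "\<nu> = density lebesgue (\<lambda>z. ennreal (weight z))"

definition form :: "(real^'n \<Rightarrow> real) \<Rightarrow> (real^'n \<Rightarrow> real) \<Rightarrow> real" where
  "form u v = (\<integral>z. increment u z * increment v z \<partial>\<nu>)"

lemma K_pos: "x \<noteq> 0 \<Longrightarrow> 0 < K x"
  using kernel unfolding admissible_kernel_def by blast

lemma Q_borel[measurable]: "Qset \<Omega> \<in> sets borel"
proof -
  have "closed ((- \<Omega>) \<times> (- \<Omega>))"
    using open_dom by (intro closed_Times closed_Compl)
  then show ?thesis
    unfolding Qset_def by (intro sets.Diff) auto
qed

lemma dom_borel[measurable]: "\<Omega> \<in> sets borel"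
  using open_dom by auto

lemma dom_lebesgue[measurable]: "\<Omega> \<in> sets lebesgue"
  using open_dom by auto

text \<open>
The integrability hypothesis is about the product of \<open>K\<close> with a positive continuous function
away from the origin; division recovers \<open>K\<close> itself.
\<close>

lemma borel_measurable_K: "K \<in> borel_measurable lebesgue"
proof (rule borel_measurable_AE)
  have "integrable lebesgue (\<lambda>x. min ((norm x)\<^sup>2) 1 * K x)"
    using kernel unfolding admissible_kernel_def by blast
  then have [measurable]: "(\<lambda>x. min ((norm x)\<^sup>2) 1 * K x) \<in> borel_measurable lebesgue"
    by (rule borel_measurable_integrable)
  have [measurable]: "(\<lambda>x. min ((norm x)\<^sup>2) 1) \<in> borel_measurable (lebesgue :: (real^'n) measure)"
    by (intro measurable_completion) simp
  show "(\<lambda>x. (min ((norm x)\<^sup>2) 1 * K x) / min ((norm x)\<^sup>2) 1) \<in> borel_measurable lebesgue"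
    by measurable
  have "AE x in lebesgue. x \<noteq> (0::real^'n)"
    by (simp add: AE_completion_iff AE_lborel_singleton)
  then show "AE x in lebesgue. (min ((norm x)\<^sup>2) 1 * K x) / min ((norm x)\<^sup>2) 1 = K x"
    by eventually_elim (auto simp: min_def)
qed

lemma weight_measurable[measurable]: "weight \<in> borel_measurable lebesgue"
proof -
  have [measurable]: "(\<lambda>z. K (fst z - snd z)) \<in> borel_measurable lebesgue"
    by (rule measurable_lebesgue_diff[OF borel_measurable_K])
  have [measurable]: "Qset \<Omega> \<in> sets lebesgue"
    by simp
  show ?thesis
    unfolding weight_def by measurable
qed

lemma weight_nonneg: "0 \<le> weight z"
  by (simp add: weight_def)

lemma measurable_\<nu>: "borel_measurable \<nu> = borel_measurable lebesgue"
  by (rule measurable_cong_sets) (simp_all add: \<nu>_def)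

lemma AE_\<nu>: "(AE z in lebesgue. P z) \<Longrightarrow> AE z in \<nu>. P z"
  unfolding \<nu>_def by (subst AE_density) (auto elim: eventually_mono)

lemma integrable_\<nu>_iff:
  fixes f :: "_ \<Rightarrow> real"
  shows "f \<in> borel_measurable lebesgue \<Longrightarrow> integrable \<nu> f \<longleftrightarrow> integrable lebesgue (\<lambda>z. weight z * f z)"
  unfolding \<nu>_def by (subst integrable_density) (auto simp: weight_nonneg)

lemma integral_\<nu>_eq:
  fixes f :: "_ \<Rightarrow> real"
  shows "f \<in> borel_measurable lebesgue \<Longrightarrow> integral\<^sup>L \<nu> f = (\<integral>z. weight z * f z \<partial>lebesgue)"
  unfolding \<nu>_def by (subst integral_density) (auto simp: weight_nonneg)

lemma integral_dom:
  fixes h :: "real^'n \<Rightarrow> real"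
  assumes [measurable]: "h \<in> borel_measurable lebesgue" and "AE x in lebesgue. x \<notin> \<Omega> \<longrightarrow> h x = 0"
  shows "set_lebesgue_integral lebesgue \<Omega> h = (\<integral>x. h x \<partial>lebesgue)"
    and "set_integrable lebesgue \<Omega> h \<longleftrightarrow> integrable lebesgue h"
proof -
  have ae: "AE x in lebesgue. indicator \<Omega> x *\<^sub>R h x = h x"
    using assms(2) by eventually_elim (auto simp: indicator_def)
  show "set_lebesgue_integral lebesgue \<Omega> h = (\<integral>x. h x \<partial>lebesgue)"
    unfolding set_lebesgue_integral_def by (rule integral_cong_AE[OF _ _ ae]) measurable
  show "set_integrable lebesgue \<Omega> h \<longleftrightarrow> integrable lebesgue h"
    unfolding set_integrable_def by (rule integrable_cong_AE[OF _ _ ae]) measurable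
qed

lemma X0_iff:
  "u \<in> X0 K \<Omega> \<longleftrightarrow> u \<in> borel_measurable lebesgue \<and> integrable lebesgue (\<lambda>x. (u x)\<^sup>2) \<and>
     integrable \<nu> (\<lambda>z. (increment u z)\<^sup>2) \<and> (AE x in lebesgue. x \<notin> \<Omega> \<longrightarrow> u x = 0)"
proof (cases "u \<in> borel_measurable lebesgue \<and> (AE x in lebesgue. x \<notin> \<Omega> \<longrightarrow> u x = 0)")
  case True
  then have [measurable]: "u \<in> borel_measurable lebesgue" 
    and ae: "AE x in lebesgue. x \<notin> \<Omega> \<longrightarrow> (u x)\<^sup>2 = 0"
    by (auto elim: eventually_mono)
  have [measurable]: "increment u \<in> borel_measurable lebesgue"
    by (rule borel_measurable_increment) fact
  have Kd[measurable]: "(\<lambda>z. K (fst z - snd z)) \<in> borel_measurable lebesgue"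
    by (rule measurable_lebesgue_diff[OF borel_measurable_K])
  have [measurable]: "Qset \<Omega> \<in> sets lebesgue"
    by simp
  have F: "(\<lambda>(x, y). (u x - u y) * sqrt (K (x - y))) = (\<lambda>z. increment u z * sqrt (K (fst z - snd z)))"
    by (auto simp: increment_def)
  have 1: "square_integrable_on u \<Omega> \<longleftrightarrow> integrable lebesgue (\<lambda>x. (u x)\<^sup>2)"
    using integral_dom(2)[OF _ ae] by (simp add: square_integrable_on_def set_borel_measurable_def)
  have 2: "square_integrable_on (\<lambda>(x, y). (u x - u y) * sqrt (K (x - y))) (Qset \<Omega>)
      \<longleftrightarrow> integrable \<nu> (\<lambda>z. (increment u z)\<^sup>2)"
  proof -
    have "set_borel_measurable lebesgue (Qset \<Omega>) (\<lambda>z. increment u z * sqrt (K (fst z - snd z)))"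
      unfolding set_borel_measurable_def by measurable
    moreover have "indicator (Qset \<Omega>) z *\<^sub>R (increment u z * sqrt (K (fst z - snd z)))\<^sup>2
        = weight z * (increment u z)\<^sup>2" for z
      by (simp add: weight_def power_mult_distrib flip: real_sqrt_power)
    ultimately show ?thesis
      unfolding F by (simp add: square_integrable_on_def set_integrable_def integrable_\<nu>_iff)
  qed
  show ?thesis
    using True 1 2 by (auto simp: X0_def Xspace_def)
qed (auto simp: X0_def Xspace_def)

lemma form_self_nonneg: "0 \<le> form u u"
  unfolding form_def by (rule integral_nonneg_AE) auto

lemma X0_norm_eq:
  assumes "u \<in> borel_measurable lebesgue"
  shows "X0_norm K \<Omega> u = sqrt (form u u)"
proof -
  have [measurable]: "increment u \<in> borel_measurable lebesgue"
    by (rule borel_measurable_increment) fact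
  have eq: "indicator (Qset \<Omega>) z *\<^sub>R (case z of (x, y) \<Rightarrow> \<bar>u x - u y\<bar>\<^sup>2 * K (x - y))
      = weight z * (increment u z * increment u z)" for z
  proof (cases "fst z = snd z")
    case False
    then have "0 < K (fst z - snd z)" by (intro K_pos) auto
    then show ?thesis
      by (simp add: weight_def increment_def power2_eq_square split: prod.split)
  qed (auto simp: increment_def split: prod.split)
  have "set_lebesgue_integral lebesgue (Qset \<Omega>) (\<lambda>(x, y). \<bar>u x - u y\<bar>\<^sup>2 * K (x - y)) = form u u"
    unfolding set_lebesgue_integral_def eq form_def by (rule integral_\<nu>_eq[symmetric]) measurable
  then show ?thesis
    by (simp add: X0_norm_def)
qed

lemma X0_norm_sq: "u \<in> borel_measurable lebesgue \<Longrightarrow> (X0_norm K \<Omega> u)\<^sup>2 = form u u"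
  by (simp add: X0_norm_eq form_self_nonneg)

lemma X0D:
  assumes "u \<in> X0 K \<Omega>"
  shows "u \<in> borel_measurable lebesgue" "integrable lebesgue (\<lambda>x. (u x)\<^sup>2)"
    "integrable \<nu> (\<lambda>z. (increment u z)\<^sup>2)" "AE x in lebesgue. x \<notin> \<Omega> \<longrightarrow> u x = 0"
    "increment u \<in> borel_measurable \<nu>"
  using assms by (auto simp: X0_iff measurable_\<nu> borel_measurable_increment)

text \<open>
Membership by comparison: every construction below comes with integrable majorants for the square
of the function and of its increment.
\<close>

lemma X0_bound:
  assumes u: "u \<in> borel_measurable lebesgue" and off: "AE x in lebesgue. x \<notin> \<Omega> \<longrightarrow> u x = 0"
    and h: "integrable lebesgue h" "\<And>x. (u x)\<^sup>2 \<le> h x"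
    and H: "integrable \<nu> H" "\<And>z. (increment u z)\<^sup>2 \<le> H z"
  shows "u \<in> X0 K \<Omega>"
proof -
  have [measurable]: "u \<in> borel_measurable lebesgue" "increment u \<in> borel_measurable \<nu>"
    using u by (auto simp: measurable_\<nu> borel_measurable_increment)
  have "integrable lebesgue (\<lambda>x. (u x)\<^sup>2)"
    by (rule Bochner_Integration.integrable_bound[OF h(1)])
       (auto intro!: AE_I2 order_trans[OF h(2)])
  moreover have "integrable \<nu> (\<lambda>z. (increment u z)\<^sup>2)"
    by (rule Bochner_Integration.integrable_bound[OF H(1)])
       (auto intro!: AE_I2 order_trans[OF H(2)])
  ultimately show ?thesis
    using u off by (simp add: X0_iff)
qed

lemma X0_diff:
  assumes u: "u \<in> X0 K \<Omega>" and v: "v \<in> X0 K \<Omega>"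
  shows "(\<lambda>x. u x - v x) \<in> X0 K \<Omega>"
proof (rule X0_bound)
  show "AE x in lebesgue. x \<notin> \<Omega> \<longrightarrow> u x - v x = 0"
    using X0D(4)[OF u] X0D(4)[OF v] by eventually_elim auto
  show "integrable lebesgue (\<lambda>x. 2 * (u x)\<^sup>2 + 2 * (v x)\<^sup>2)"
    using X0D(2)[OF u] X0D(2)[OF v] by auto
  show "integrable \<nu> (\<lambda>z. 2 * (increment u z)\<^sup>2 + 2 * (increment v z)\<^sup>2)"
    using X0D(3)[OF u] X0D(3)[OF v] by auto
  show "(u x - v x)\<^sup>2 \<le> 2 * (u x)\<^sup>2 + 2 * (v x)\<^sup>2" for x
    using square_sum_le[of "u x" "- v x"] by simp
  show "(increment (\<lambda>x. u x - v x) z)\<^sup>2 \<le> 2 * (increment u z)\<^sup>2 + 2 * (increment v z)\<^sup>2" for z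
  proof -
    have "increment (\<lambda>x. u x - v x) z = increment u z + - increment v z"
      by (simp add: increment_def)
    then show ?thesis
      using square_sum_le[of "increment u z" "- increment v z"] by simp
  qed
qed (use X0D(1)[OF u] X0D(1)[OF v] in measurable)

lemma integrable_increment_mult:
  assumes u: "u \<in> X0 K \<Omega>" and v: "v \<in> X0 K \<Omega>"
  shows "integrable \<nu> (\<lambda>z. increment u z * increment v z)"
proof (rule Bochner_Integration.integrable_bound)
  show "integrable \<nu> (\<lambda>z. (increment u z)\<^sup>2 + (increment v z)\<^sup>2)"
    using X0D(3)[OF u] X0D(3)[OF v] by auto
  show "(\<lambda>z. increment u z * increment v z) \<in> borel_measurable \<nu>"
    using X0D(5)[OF u] X0D(5)[OF v] by measurable
  have "\<bar>a * b\<bar> \<le> a\<^sup>2 + b\<^sup>2" for a b :: real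
    using zero_le_power2[of "\<bar>a\<bar> - \<bar>b\<bar>"] mult_nonneg_nonneg[of "\<bar>a\<bar>" "\<bar>b\<bar>"]
    unfolding abs_mult power2_diff power2_abs by linarith
  then show "AE z in \<nu>. norm (increment u z * increment v z) \<le> norm ((increment u z)\<^sup>2 + (increment v z)\<^sup>2)"
    by (auto intro!: AE_I2)
qed

lemma form_self: "form u u = (\<integral>z. (increment u z)\<^sup>2 \<partial>\<nu>)"
  by (simp add: form_def power2_eq_square)

text \<open>
Integrals over the product are computed by iterated integration of Borel functions; the energy
does not see the change on a null set.
\<close>

lemma borel_representative:
  assumes u: "u \<in> X0 K \<Omega>"
  obtains v where "v \<in> borel_measurable borel" "\<And>x. x \<notin> \<Omega> \<Longrightarrow> v x = 0"
    "AE x in lebesgue. v x = u x" "AE z in lebesgue. increment v z = increment u z"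
proof -
  obtain g where g[measurable]: "g \<in> borel_measurable borel" and ug: "AE x in lborel. u x = g x"
    using completion_ex_borel_measurable_real[OF X0D(1)[OF u]] by auto
  define v where "v x = indicator \<Omega> x * g x" for x
  have "v \<in> borel_measurable borel"
    unfolding v_def by measurable
  moreover have "AE x in lebesgue. u x = g x"
    using ug by (simp add: AE_completion_iff)
  then have "AE x in lebesgue. v x = u x"
    using X0D(4)[OF u] by eventually_elim (auto simp: v_def indicator_def)
  ultimately show thesis
    by (intro that[of v] AE_increment) (auto simp: v_def)
qed

definition \<kappa> :: "real \<Rightarrow> real" where
  "\<kappa> r = c * r powr (- (real CARD('n) + 2 * s))"

lemma \<kappa>_pos: "0 < r \<Longrightarrow> 0 < \<kappa> r"
  using c_pos by (simp add: \<kappa>_def)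

lemma kernel_ge_\<kappa>: "x \<noteq> 0 \<Longrightarrow> norm x \<le> r \<Longrightarrow> \<kappa> r \<le> K x"
  using s_pos c_pos
  by (intro order_trans[OF _ kernel_ge]) (auto simp: \<kappa>_def intro!: mult_left_mono powr_mono2')

text \<open>
On a set of pairs of distance at most \<open>r\<close>, the measure \<open>\<nu>\<close> dominates \<open>\<kappa> r\<close> times Lebesgue
measure. This is the only way in which the lower bound of the kernel is used.
\<close>

lemma integral_\<nu>_ge:
  assumes [measurable]: "G \<in> borel_measurable borel" "S \<in> sets borel"
    and S: "S \<subseteq> Qset \<Omega>" "\<And>x y. (x, y) \<in> S \<Longrightarrow> norm (x - y) \<le> r" and r: "0 < r"
    and H: "integrable \<nu> H" "\<And>z. 0 \<le> H z"
    and GH: "AE z in lebesgue. z \<in> S \<longrightarrow> G z \<le> H z"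
  shows "ennreal (\<kappa> r) * (\<integral>\<^sup>+z. ennreal (G z) * indicator S z \<partial>lborel) \<le> ennreal (\<integral>z. H z \<partial>\<nu>)"
proof -
  have [measurable]: "H \<in> borel_measurable lebesgue"
    using borel_measurable_integrable[OF H(1)] by (simp add: measurable_\<nu>)
  have "AE x in lebesgue. x \<noteq> (0::real^'n)"
    by (simp add: AE_completion_iff AE_lborel_singleton)
  then have "AE z in lebesgue. fst z - snd z \<noteq> (0::real^'n)"
    by (rule AE_lebesgue_diff)
  with GH have le: "AE z in lebesgue. ennreal (\<kappa> r) * (ennreal (G z) * indicator S z)
      \<le> ennreal (weight z) * ennreal (H z)"
  proof eventually_elim
    case (elim z)
    show ?case
    proof (cases "z \<in> S")
      case True
      then have "\<kappa> r \<le> weight z"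
        using S elim(2) kernel_ge_\<kappa>[of "fst z - snd z" r] by (auto simp: weight_def indicator_def) 
      then show ?thesis
        using True elim(1) by (auto intro!: mult_mono ennreal_leI)
    qed simp
  qed
  have "ennreal (\<kappa> r) * (\<integral>\<^sup>+z. ennreal (G z) * indicator S z \<partial>lborel)
      \<le> (\<integral>\<^sup>+z. ennreal (\<kappa> r) * (ennreal (G z) * indicator S z) \<partial>lebesgue)"
    unfolding nn_integral_completion by (simp add: nn_integral_cmult)
  also have "\<dots> \<le> (\<integral>\<^sup>+z. ennreal (weight z) * ennreal (H z) \<partial>lebesgue)"
    by (rule nn_integral_mono_AE[OF le])
  also have "\<dots> = (\<integral>\<^sup>+z. ennreal (H z) \<partial>\<nu>)"
    unfolding \<nu>_def by (rule nn_integral_density[symmetric]) measurable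
  also have "\<dots> = ennreal (\<integral>z. H z \<partial>\<nu>)"
    by (rule nn_integral_eq_integral) (use H in auto)
  finally show ?thesis .
qed

lemma Psphere_iff: "u \<in> Psphere K \<Omega> \<longleftrightarrow> u \<in> X0 K \<Omega> \<and> (\<integral>x. (u x)\<^sup>2 \<partial>lebesgue) = 1"
proof (cases "u \<in> X0 K \<Omega>")
  case True
  have "AE x in lebesgue. x \<notin> \<Omega> \<longrightarrow> (u x)\<^sup>2 = 0"
    by (rule eventually_mono[OF X0D(4)[OF True]]) auto
  then show ?thesis
    using True X0D(1)[OF True] by (simp add: Psphere_def integral_dom(1))
qed (simp add: Psphere_def)

lemma Jfun_eq:
  assumes u: "u \<in> X0 K \<Omega>"
  shows "Jfun K \<Omega> p u = form u u - p * (\<integral>x. (max (u x) 0)\<^sup>2 \<partial>lebesgue)"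
proof -
  have [measurable]: "u \<in> borel_measurable lebesgue"
    by (rule X0D(1)[OF u])
  have "AE x in lebesgue. x \<notin> \<Omega> \<longrightarrow> (max (u x) 0)\<^sup>2 = 0"
    by (rule eventually_mono[OF X0D(4)[OF u]]) auto
  then show ?thesis
    by (simp add: Jfun_def X0_norm_sq integral_dom(1))
qed

lemma X0_scale:
  assumes u: "u \<in> X0 K \<Omega>"
  shows "(\<lambda>x. k * u x) \<in> X0 K \<Omega>"
proof (rule X0_bound)
  have "increment (\<lambda>x. k * u x) z = k * increment u z" for z
    by (simp add: increment_def algebra_simps)
  then show "(increment (\<lambda>x. k * u x) z)\<^sup>2 \<le> k\<^sup>2 * (increment u z)\<^sup>2" for z
    by (simp add: power_mult_distrib)
  show "AE x in lebesgue. x \<notin> \<Omega> \<longrightarrow> k * u x = 0"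
    by (rule eventually_mono[OF X0D(4)[OF u]]) auto
  show "(\<lambda>x. k * u x) \<in> borel_measurable lebesgue"
    using X0D(1)[OF u] by measurable
  show "(k * u x)\<^sup>2 \<le> k\<^sup>2 * (u x)\<^sup>2" for x
    by (simp add: power_mult_distrib)
qed (use X0D[OF u] in auto)

lemma form_scale: "form (\<lambda>x. k * u x) (\<lambda>x. l * v x) = k * l * form u v"
proof -
  have "increment (\<lambda>x. k * u x) z * increment (\<lambda>x. l * v x) z
      = k * l * (increment u z * increment v z)" for z
    by (simp add: increment_def algebra_simps)
  then show ?thesis
    by (simp add: form_def)
qed

lemma form_disjoint_nonpos:
  assumes "\<And>x. 0 \<le> f x" "\<And>x. 0 \<le> g x" "\<And>x. f x * g x = 0"
  shows "form f g \<le> 0"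
proof -
  have "0 \<le> (\<integral>z. - (increment f z * increment g z) \<partial>\<nu>)"
    unfolding increment_mult_disjoint[OF assms(3)] using assms(1,2) by (intro integral_nonneg_AE AE_I2) auto
  then show ?thesis
    by (simp add: form_def)
qed

lemma lambda1_le:
  assumes "u \<in> Psphere K \<Omega>"
  shows "lambda1 K \<Omega> \<le> form u u"
proof -
  have "lambda1 K \<Omega> \<le> (X0_norm K \<Omega> u)\<^sup>2"
    unfolding lambda1_def using assms by (intro cINF_lower bdd_belowI2[of _ 0]) auto
  then show ?thesis
    using assms by (simp add: Psphere_iff X0_norm_sq X0D(1))
qed

text \<open>
Truncation is a contraction, so it shrinks increments.
\<close>

lemma X0_truncate:
  assumes u: "u \<in> X0 K \<Omega>"
  shows "(\<lambda>x. max (u x) 0) \<in> X0 K \<Omega>" "(\<lambda>x. max (- u x) 0) \<in> X0 K \<Omega>"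
proof -
  have P: "(\<lambda>x. max (w x) 0) \<in> X0 K \<Omega>" if w: "w \<in> X0 K \<Omega>" for w
  proof (rule X0_bound)
    show "(\<lambda>x. max (w x) 0) \<in> borel_measurable lebesgue"
      using X0D(1)[OF w] by measurable
    show "AE x in lebesgue. x \<notin> \<Omega> \<longrightarrow> max (w x) 0 = 0"
      by (rule eventually_mono[OF X0D(4)[OF w]]) auto
    show "(max (w x) 0)\<^sup>2 \<le> (w x)\<^sup>2" for x
      by (simp add: max_def)
    show "(increment (\<lambda>x. max (w x) 0) z)\<^sup>2 \<le> (increment w z)\<^sup>2" for z
      by (rule abs_le_square_iff[THEN iffD1]) (auto simp: increment_def max_def)
  qed (use X0D[OF w] in auto)
  from P[OF u] P[OF X0_scale[OF u, of "-1"]]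
  show "(\<lambda>x. max (u x) 0) \<in> X0 K \<Omega>" "(\<lambda>x. max (- u x) 0) \<in> X0 K \<Omega>" by simp_all
qed

section \<open>Lower bounds for the energy\<close>

lemma nn_integral_representative:
  assumes "u \<in> X0 K \<Omega>" "AE x in lebesgue. v x = u x"
  shows "(\<integral>\<^sup>+x. ennreal ((v x)\<^sup>2) \<partial>lborel) = ennreal (\<integral>x. (u x)\<^sup>2 \<partial>lebesgue)"
proof -
  have "(\<integral>\<^sup>+x. ennreal ((v x)\<^sup>2) \<partial>lborel) = (\<integral>\<^sup>+x. ennreal ((u x)\<^sup>2) \<partial>lebesgue)"
    by (rule nn_integral_lborel_cong_lebesgue, rule eventually_mono[OF assms(2)]) simp
  also have "\<dots> = ennreal (\<integral>x. (u x)\<^sup>2 \<partial>lebesgue)"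
    by (rule nn_integral_eq_integral[OF X0D(2)[OF assms(1)]]) auto
  finally show ?thesis .
qed

text \<open>
Elements of the space vanish on a ball \<open>W\<close> away from the domain, so for $x\in\Omega$ and $y\in W$
the increment is $u(x)$. The kernel is bounded below on $\Omega\times W$.
\<close>

lemma poincare: "\<exists>C>0. \<forall>u\<in>X0 K \<Omega>. (\<integral>x. (u x)\<^sup>2 \<partial>lebesgue) \<le> C * form u u"
proof -
  obtain R where R: "0 < R" "\<Omega> \<subseteq> ball 0 R"
    using bounded_subset_ballD[OF bounded_dom, of 0] by auto
  \<comment> \<open>The ball of radius $R$ around $e$ touches the ball around the origin that contains $\Omega$, but does not meet it.\<close>
  obtain e :: "real^'n" where e: "norm e = 2 * R"
    using vector_choose_size[of "2 * R"] R by auto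
  define w where "w = measure lborel (ball e R)"
  have w: "0 < w"
    using R by (simp add: w_def content_ball_pos)
  have w': "emeasure lborel (ball e R) = ennreal w"
    using emeasure_lborel_ball_finite[of e R] by (simp add: w_def emeasure_eq_ennreal_measure less_top)
  have far: "y \<notin> \<Omega>" "norm (x - y) \<le> 4 * R" if "x \<in> \<Omega>" "y \<in> ball e R" for x y
  proof -
    have *: "norm x < R" "norm (e - y) < R"
      using that R by (auto simp: dist_norm)
    have "norm e \<le> norm (e - y) + norm y"
      using norm_triangle_ineq[of "e - y" y] by simp
    with * e have "R < norm y" by linarith
    then show "y \<notin> \<Omega>" using R by auto
    have "norm y \<le> norm (e - y) + norm e"
      using norm_triangle_ineq4[of e "e - y"] by simp
    then show "norm (x - y) \<le> 4 * R"
      using * e norm_triangle_ineq4[of x y] by linarith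
  qed
  define k where "k = \<kappa> (4 * R) * w"
  have k: "0 < k"
    using w R by (auto simp: k_def intro!: mult_pos_pos \<kappa>_pos)
  have "(\<integral>x. (u x)\<^sup>2 \<partial>lebesgue) \<le> (1 / k) * form u u" if u: "u \<in> X0 K \<Omega>" for u
  proof -
    obtain v where [measurable]: "v \<in> borel_measurable borel" and v0: "\<And>x. x \<notin> \<Omega> \<Longrightarrow> v x = 0"
      and vu: "AE x in lebesgue. v x = u x" and dvu: "AE z in lebesgue. increment v z = increment u z"
      using borel_representative[OF u] by blast
    have "ennreal (\<kappa> (4 * R)) * (\<integral>\<^sup>+z. ennreal ((v (fst z))\<^sup>2) * indicator (\<Omega> \<times> ball e R) z \<partial>lborel)
        \<le> ennreal (\<integral>z. (increment u z)\<^sup>2 \<partial>\<nu>)"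
    proof (rule integral_\<nu>_ge)
      show "\<Omega> \<times> ball e R \<in> sets borel"
        by (auto simp: borel_Times)
      show "\<Omega> \<times> ball e R \<subseteq> Qset \<Omega>"
        by (auto simp: Qset_def)
      show "AE z in lebesgue. z \<in> \<Omega> \<times> ball e R \<longrightarrow> (v (fst z))\<^sup>2 \<le> (increment u z)\<^sup>2"
        using dvu
      proof eventually_elim
        case (elim z)
        then show ?case
          using v0[of "snd z"] far(1)[of "fst z" "snd z"] by (auto simp: increment_def)
      qed
    qed (use R far X0D(3)[OF u] in \<open>auto simp: borel_prod[symmetric]\<close>)
    also have "(\<integral>\<^sup>+z. ennreal ((v (fst z))\<^sup>2) * indicator (\<Omega> \<times> ball e R) z \<partial>lborel)
        = (\<integral>\<^sup>+z. ennreal ((v (fst z))\<^sup>2) * indicator (ball e R) (snd z) \<partial>lborel)"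
      by (intro nn_integral_cong) (use v0 in \<open>force simp: indicator_def\<close>)
    also have "\<dots> = ennreal (\<integral>x. (u x)\<^sup>2 \<partial>lebesgue) * ennreal w"
      by (subst nn_integral_lborel_product)
         (auto simp: nn_integral_representative[OF u vu] w' intro!: borel_measurable_indicator)
    finally have "ennreal (\<kappa> (4 * R) * ((\<integral>x. (u x)\<^sup>2 \<partial>lebesgue) * w)) \<le> ennreal (form u u)"
      using w R(1) \<kappa>_pos[of "4 * R"] by (simp add: ennreal_mult form_self)
    then have "\<kappa> (4 * R) * ((\<integral>x. (u x)\<^sup>2 \<partial>lebesgue) * w) \<le> form u u"
      by (simp add: ennreal_le_iff[OF form_self_nonneg])
    then show ?thesis
      using k by (simp add: k_def field_simps)
  qed
  then show ?thesis
    using k by (intro exI[of _ "1 / k"]) auto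
qed

text \<open>
A Nash-type inequality. Integrate $f(x)^2\le 2f(x)f(y)+(f(x)-f(y))^2$ over pairs with $x\in\Omega$ and
$|x-y|<r$. The left side gives the volume $V$ of the ball of radius $r$, the first term on the right
at most $2\|f\|_1^2$, and the second at most $C/\kappa(r)$. The latter is of the order of $r^{n+2s}$
whereas $V$ is of the order of $r^n$, so it is at most $V/2$ for small $r$.
\<close>

lemma L1_lower_bound:
  "\<exists>\<delta>>0. \<forall>f\<in>X0 K \<Omega>. (\<forall>x. 0 \<le> f x) \<longrightarrow> (\<integral>x. (f x)\<^sup>2 \<partial>lebesgue) = 1 \<longrightarrow> form f f \<le> C \<longrightarrow>
     ennreal \<delta> \<le> (\<integral>\<^sup>+x. ennreal (f x) \<partial>lebesgue)"
proof -
  define B where "B = max C 1"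
  have B: "0 < B" "C \<le> B" by (auto simp: B_def)
  define b where "b = unit_ball_vol (real CARD('n))"
  have b: "0 < b" by (simp add: b_def)
  \<comment> \<open>This radius solves $B / \<kappa>(r) = V / 2$, where $V$ is the volume of the ball of radius $r$.\<close>
  define r where "r = (c * b / (2 * B)) powr (1 / (2 * s))"
  have r: "0 < r" using b B c_pos by (simp add: r_def)
  define V where "V = b * r ^ CARD('n)"
  have V: "0 < V" using b r by (simp add: V_def)
  have ball_V: "emeasure lborel (ball x r) = ennreal V" for x :: "real^'n"
    using r by (simp add: emeasure_ball V_def b_def)
  have "r powr (2 * s) = c * b / (2 * B)"
    using s_pos b B c_pos by (simp add: r_def powr_powr)
  moreover have "\<kappa> r * (V / 2) * r powr (2 * s) = c * b / 2"
  proof -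
    have "\<kappa> r * (V / 2) * r powr (2 * s)
        = c * b / 2 * (r powr (- (real CARD('n) + 2 * s)) * r powr real CARD('n) * r powr (2 * s))"
      using r by (simp add: \<kappa>_def V_def powr_realpow)
    also have "r powr (- (real CARD('n) + 2 * s)) * r powr real CARD('n) * r powr (2 * s) = 1"
      using r by (simp flip: powr_add)
    finally show ?thesis by simp
  qed
  ultimately have "\<kappa> r * (V / 2) * r powr (2 * s) = B * r powr (2 * s)"
    using B by simp
  then have kV: "\<kappa> r * (V / 2) = B"
    using r by simp
  define S where "S = {z::(real^'n) \<times> (real^'n). fst z \<in> \<Omega> \<and> norm (fst z - snd z) < r}"
  have S[measurable]: "S \<in> sets borel"
  proof -
    have "open S"
      unfolding S_def
      by (intro open_Collect_conj open_Collect_less open_vimage_fst[OF open_dom, unfolded vimage_def]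
          continuous_intros)
    then show ?thesis by auto
  qed
  have "ennreal (sqrt V / 2) \<le> (\<integral>\<^sup>+x. ennreal (f x) \<partial>lebesgue)"
    if f: "f \<in> X0 K \<Omega>" and nonneg: "\<And>x. 0 \<le> f x" and mass: "(\<integral>x. (f x)\<^sup>2 \<partial>lebesgue) = 1"
      and energy: "form f f \<le> C" for f
  proof -
    obtain v where [measurable]: "v \<in> borel_measurable borel" and v0: "\<And>x. x \<notin> \<Omega> \<Longrightarrow> v x = 0"
      and vf: "AE x in lebesgue. v x = f x"  and dvf: "AE z in lebesgue. increment v z = increment f z"
      using borel_representative[OF f] by blast
    define I where "I = (\<integral>\<^sup>+x. ennreal (v x) \<partial>lborel)"
    define T where "T = (\<integral>\<^sup>+z. ennreal ((increment v z)\<^sup>2) * indicator S z \<partial>lborel)"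
    have [measurable]: "increment v \<in> borel_measurable (borel \<Otimes>\<^sub>M borel)"
      unfolding increment_def by measurable
    then have [measurable]: "increment v \<in> borel_measurable borel"
      unfolding borel_prod .
    have [measurable]: "S \<in> sets (borel \<Otimes>\<^sub>M borel)"
      using S unfolding borel_prod .
    have "ennreal (\<kappa> r) * T \<le> ennreal (\<integral>z. (increment f z)\<^sup>2 \<partial>\<nu>)"
      unfolding T_def
    proof (rule integral_\<nu>_ge)
      show "S \<in> sets borel" by fact
      show "AE z in lebesgue. z \<in> S \<longrightarrow> (increment v z)\<^sup>2 \<le> (increment f z)\<^sup>2"
        using dvf by eventually_elim simp
    qed (use r X0D(3)[OF f] in \<open>auto simp: S_def Qset_def\<close>)
    also have "\<dots> \<le> ennreal (\<kappa> r) * ennreal (V / 2)"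
      using energy B kV \<kappa>_pos[OF r] V by (simp add: form_self flip: ennreal_mult)
    finally have T: "T \<le> ennreal (V / 2)"
      using \<kappa>_pos[OF r] by (simp add: ennreal_mult_le_mult_iff)
    have "ennreal V = (\<integral>\<^sup>+x. ennreal ((v x)\<^sup>2) \<partial>lborel) * ennreal V"
      by (simp add: nn_integral_representative[OF f vf] mass)
    also have "\<dots> = (\<integral>\<^sup>+x. \<integral>\<^sup>+y. ennreal ((v x)\<^sup>2) * indicator S (x, y) \<partial>lborel \<partial>lborel)"
    proof (subst nn_integral_multc[symmetric], measurable, rule nn_integral_cong)
      fix x :: "real^'n"
      have "(\<integral>\<^sup>+y. ennreal ((v x)\<^sup>2) * indicator S (x, y) \<partial>lborel)
          = (\<integral>\<^sup>+y. ennreal ((v x)\<^sup>2) * indicator (ball x r) y \<partial>lborel)"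
        by (intro nn_integral_cong) (auto simp: S_def indicator_def v0 dist_norm)
      also have "\<dots> = ennreal ((v x)\<^sup>2) * ennreal V"
        by (subst nn_integral_cmult) (auto simp: ball_V intro!: borel_measurable_indicator)
      finally show "ennreal ((v x)\<^sup>2) * ennreal V
          = (\<integral>\<^sup>+y. ennreal ((v x)\<^sup>2) * indicator S (x, y) \<partial>lborel)"
        by (rule sym)
    qed
    also have "\<dots> = (\<integral>\<^sup>+z. ennreal ((v (fst z))\<^sup>2) * indicator S z \<partial>lborel)"
      unfolding lborel_prod[symmetric]
      by (subst lborel.nn_integral_fst[symmetric]) auto
    also have "\<dots> \<le> (\<integral>\<^sup>+z. 2 * (ennreal (v (fst z)) * ennreal (v (snd z)))
        + ennreal ((increment v z)\<^sup>2) * indicator S z \<partial>lborel)"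
    proof (rule nn_integral_mono_AE)
      have "AE x in lebesgue. 0 \<le> v x"
        using vf by eventually_elim (simp add: nonneg)
      from AE_lebesgue_fst[OF this] AE_lebesgue_snd[OF this]
      have "AE z in lborel. 0 \<le> v (fst z) \<and> 0 \<le> v (snd z)"
        by (simp add: AE_completion_iff)
      then show "AE z in lborel. ennreal ((v (fst z))\<^sup>2) * indicator S z
          \<le> 2 * (ennreal (v (fst z)) * ennreal (v (snd z))) + ennreal ((increment v z)\<^sup>2) * indicator S z"
      proof eventually_elim
        case (elim z)
        have "(v (fst z))\<^sup>2 \<le> 2 * (v (fst z) * v (snd z)) + (increment v z)\<^sup>2"
          by (simp add: increment_def power2_eq_square algebra_simps)
        then have "ennreal ((v (fst z))\<^sup>2) \<le> ennreal (2 * (v (fst z) * v (snd z)) + (increment v z)\<^sup>2)"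
          by (rule ennreal_leI)
        also have "\<dots> = 2 * (ennreal (v (fst z)) * ennreal (v (snd z))) + ennreal ((increment v z)\<^sup>2)"
          using elim by (simp add: ennreal_mult)
        finally show ?case
          by (auto simp: indicator_def)
      qed
    qed
    also have "\<dots> = 2 * (I * I) + T"
      unfolding T_def I_def
      by (subst nn_integral_add) (auto simp: nn_integral_cmult nn_integral_lborel_product[symmetric] borel_prod[symmetric])
    also have "\<dots> \<le> 2 * (I * I) + ennreal (V / 2)"
      using T by (intro add_left_mono)
    finally have main: "ennreal V \<le> 2 * (I * I) + ennreal (V / 2)" .
    have "ennreal (sqrt V / 2) \<le> I"
    proof (rule ccontr)
      assume "\<not> ennreal (sqrt V / 2) \<le> I"
      then have lt: "I < ennreal (sqrt V / 2)" by simp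
      then obtain i where i: "0 \<le> i" "I = ennreal i"
        by (cases I) auto
      have "i < sqrt V / 2"
        using lt i by (simp add: ennreal_less_iff)
      then have "i * i < (sqrt V / 2) * (sqrt V / 2)"
        using i by (intro mult_strict_mono') auto
      also have "(sqrt V / 2) * (sqrt V / 2) = V / 4"
        using V by (simp add: real_sqrt_mult_self)
      finally have "4 * (i * i) < V"
        by linarith
      moreover have "ennreal V \<le> ennreal (2 * (i * i) + V / 2)"
        using main i V unfolding i(2) by (simp add: ennreal_mult ennreal_plus)
      then have "V \<le> 2 * (i * i) + V / 2"
        using i V by (subst (asm) ennreal_le_iff) auto
      ultimately show False by linarith
    qed
    also have "I = (\<integral>\<^sup>+x. ennreal (f x) \<partial>lebesgue)"
      unfolding I_def
      by (rule nn_integral_lborel_cong_lebesgue, rule eventually_mono[OF vf]) simp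
    finally show ?thesis .
  qed
  then show ?thesis
    using V by (intro exI[of _ "sqrt V / 2"]) auto
qed

text \<open>
The shape of the normalised positive and negative parts of a sign-changing function.
\<close>

definition nodal_pair :: "(real^'n \<Rightarrow> real) \<Rightarrow> (real^'n \<Rightarrow> real) \<Rightarrow> bool" where
  "nodal_pair f g \<longleftrightarrow> f \<in> X0 K \<Omega> \<and> g \<in> X0 K \<Omega> \<and> (\<forall>x. 0 \<le> f x) \<and> (\<forall>x. 0 \<le> g x) \<and>
     (\<forall>x. f x * g x = 0) \<and> (\<integral>x. (f x)\<^sup>2 \<partial>lebesgue) = 1 \<and> (\<integral>x. (g x)\<^sup>2 \<partial>lebesgue) = 1"

text \<open>
The interaction of the two functions is an integral of $f(x)g(y)K(x-y)$. The kernel is bounded below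
on $\Omega\times\Omega$, so the interaction is at least a constant times $\|f\|_1\|g\|_1$. This is where
nonlocality enters: disjoint functions always interact.
\<close>

lemma coupling_lower_bound:
  "\<exists>d>0. \<forall>f g. nodal_pair f g \<longrightarrow> form f f \<le> C \<longrightarrow> form g g \<le> C \<longrightarrow> d \<le> - form f g"
proof -
  obtain \<delta> where \<delta>: "0 < \<delta>" and L1: "\<And>f. f \<in> X0 K \<Omega> \<Longrightarrow> (\<And>x. 0 \<le> f x) \<Longrightarrow>
      (\<integral>x. (f x)\<^sup>2 \<partial>lebesgue) = 1 \<Longrightarrow> form f f \<le> C \<Longrightarrow> ennreal \<delta> \<le> (\<integral>\<^sup>+x. ennreal (f x) \<partial>lebesgue)"
    using L1_lower_bound[of C] by metis
  obtain R where R: "0 < R" "\<Omega> \<subseteq> ball 0 R"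
    using bounded_subset_ballD[OF bounded_dom, of 0] by auto
  define d where "d = \<kappa> (2 * R) * (\<delta> * \<delta>)"
  have d: "0 < d"
    using \<delta> R by (auto simp: d_def intro!: mult_pos_pos \<kappa>_pos)
  have "d \<le> - form f g" if fg: "nodal_pair f g" and E: "form f f \<le> C" "form g g \<le> C" for f g
  proof -
    have f: "f \<in> X0 K \<Omega>" "\<And>x. 0 \<le> f x" "(\<integral>x. (f x)\<^sup>2 \<partial>lebesgue) = 1"
      and g: "g \<in> X0 K \<Omega>" "\<And>x. 0 \<le> g x" "(\<integral>x. (g x)\<^sup>2 \<partial>lebesgue) = 1"
      and disj: "\<And>x. f x * g x = 0"
      using fg by (auto simp: nodal_pair_def)
    obtain v where [measurable]: "v \<in> borel_measurable borel" and v0: "\<And>x. x \<notin> \<Omega> \<Longrightarrow> v x = 0"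
      and vf: "AE x in lebesgue. v x = f x"
      using borel_representative[OF f(1)] by blast
    obtain w where [measurable]: "w \<in> borel_measurable borel" and w0: "\<And>x. x \<notin> \<Omega> \<Longrightarrow> w x = 0"
      and wg: "AE x in lebesgue. w x = g x"
      using borel_representative[OF g(1)] by blast
    have v_ge: "ennreal \<delta> \<le> (\<integral>\<^sup>+x. ennreal (v x) \<partial>lborel)"
    proof -
      have "(\<integral>\<^sup>+x. ennreal (v x) \<partial>lborel) = (\<integral>\<^sup>+x. ennreal (f x) \<partial>lebesgue)"
        by (rule nn_integral_lborel_cong_lebesgue, rule eventually_mono[OF vf]) simp
      then show ?thesis using L1[OF f E(1)] by simp
    qed
    have w_ge: "ennreal \<delta> \<le> (\<integral>\<^sup>+x. ennreal (w x) \<partial>lborel)"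
    proof -
      have "(\<integral>\<^sup>+x. ennreal (w x) \<partial>lborel) = (\<integral>\<^sup>+x. ennreal (g x) \<partial>lebesgue)"
        by (rule nn_integral_lborel_cong_lebesgue, rule eventually_mono[OF wg]) simp
      then show ?thesis using L1[OF g E(2)] by simp
    qed
    have ae: "AE z in lebesgue. v (fst z) = f (fst z) \<and> w (snd z) = g (snd z)"
      using AE_lebesgue_fst[OF vf] AE_lebesgue_snd[OF wg] by eventually_elim simp
    have ae_lborel: "AE z in lborel. v (fst z) = f (fst z) \<and> w (snd z) = g (snd z)"
      using ae by (simp add: AE_completion_iff)
    have "ennreal d = ennreal (\<kappa> (2 * R)) * (ennreal \<delta> * ennreal \<delta>)"
      using \<delta> R \<kappa>_pos[of "2 * R"] by (simp add: d_def ennreal_mult)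
    also have "\<dots> \<le> ennreal (\<kappa> (2 * R)) * ((\<integral>\<^sup>+x. ennreal (v x) \<partial>lborel) * (\<integral>\<^sup>+x. ennreal (w x) \<partial>lborel))"
      by (intro mult_left_mono mult_mono v_ge w_ge) auto
    also have "(\<integral>\<^sup>+x. ennreal (v x) \<partial>lborel) * (\<integral>\<^sup>+x. ennreal (w x) \<partial>lborel)
        = (\<integral>\<^sup>+z. ennreal (v (fst z)) * ennreal (w (snd z)) \<partial>lborel)"
      by (rule nn_integral_lborel_product[symmetric]) auto
    also have "\<dots> = (\<integral>\<^sup>+z. ennreal (v (fst z) * w (snd z)) * indicator (\<Omega> \<times> \<Omega>) z \<partial>lborel)"
    proof (rule nn_integral_cong_AE)
      show "AE z in lborel. ennreal (v (fst z)) * ennreal (w (snd z))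
          = ennreal (v (fst z) * w (snd z)) * indicator (\<Omega> \<times> \<Omega>) z"
        using ae_lborel
      proof eventually_elim
        case (elim z)
        then have "0 \<le> v (fst z)" "0 \<le> w (snd z)" by (auto simp: f g)
        then show ?case
          using v0[of "fst z"] w0[of "snd z"]
          by (cases z) (auto simp: ennreal_mult indicator_def)
      qed
    qed
    also have "ennreal (\<kappa> (2 * R)) * \<dots> \<le> ennreal (\<integral>z. - (increment f z * increment g z) \<partial>\<nu>)"
    proof (rule integral_\<nu>_ge)
      show "(\<lambda>z. v (fst z) * w (snd z)) \<in> borel_measurable borel"
        by (simp add: borel_prod[symmetric])
      show "\<Omega> \<times> \<Omega> \<in> sets borel"
        by (auto simp: borel_Times)
      show "norm (x - y) \<le> 2 * R" if "(x, y) \<in> \<Omega> \<times> \<Omega>" for x y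
      proof -
        have "norm x < R" "norm y < R" using that R by auto
        then show ?thesis using norm_triangle_ineq4[of x y] by linarith
      qed
      show "integrable \<nu> (\<lambda>z. - (increment f z * increment g z))"
        using integrable_increment_mult[OF f(1) g(1)] by simp
      show "0 \<le> - (increment f z * increment g z)" for z
        unfolding increment_mult_disjoint[OF disj] using f(2) g(2) by simp
      show "AE z in lebesgue. z \<in> \<Omega> \<times> \<Omega> \<longrightarrow> v (fst z) * w (snd z) \<le> - (increment f z * increment g z)"
        using ae
      proof eventually_elim
        case (elim z)
        then show ?case
          unfolding increment_mult_disjoint[OF disj] using f(2) g(2) by simp
      qed
    qed (use R in \<open>auto simp: Qset_def\<close>)
    also have "\<dots> = ennreal (- form f g)"
      by (simp add: form_def)
    finally show ?thesis
      using d by (cases "0 \<le> - form f g") (auto simp: ennreal_neg)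
  qed
  then show ?thesis
    using d by auto
qed

section \<open>Disjoint test functions\<close>

lemma nodal_pair_normalize:
  assumes u: "u \<in> X0 K \<Omega>" "\<And>x. 0 \<le> u x" "0 < (\<integral>x. (u x)\<^sup>2 \<partial>lebesgue)"
    and v: "v \<in> X0 K \<Omega>" "\<And>x. 0 \<le> v x" "0 < (\<integral>x. (v x)\<^sup>2 \<partial>lebesgue)"
    and disj: "\<And>x. u x * v x = 0"
  shows "nodal_pair (\<lambda>x. 1 / sqrt (\<integral>x. (u x)\<^sup>2 \<partial>lebesgue) * u x) (\<lambda>x. 1 / sqrt (\<integral>x. (v x)\<^sup>2 \<partial>lebesgue) * v x)"
proof -
  have "(\<integral>x. (1 / sqrt k * w x)\<^sup>2 \<partial>lebesgue) = 1"
    if "0 < k" "k = (\<integral>x. (w x)\<^sup>2 \<partial>lebesgue)" for k and w :: "real^'n \<Rightarrow> real"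
  proof -
    have "(1 / sqrt k * w x)\<^sup>2 = (1 / k) * (w x)\<^sup>2" for x
      using that(1) by (simp add: power_mult_distrib power_divide)
    then have "(\<integral>x. (1 / sqrt k * w x)\<^sup>2 \<partial>lebesgue) = (1 / k) * (\<integral>x. (w x)\<^sup>2 \<partial>lebesgue)"
      by simp
    then show ?thesis
      using that by simp
  qed
  moreover have "(\<lambda>x. w x / sqrt k) \<in> X0 K \<Omega>" if "w \<in> X0 K \<Omega>" for k w
    using X0_scale[OF that, of "1 / sqrt k"] by simp
  ultimately show ?thesis
    unfolding nodal_pair_def using u v disj by auto
qed

text \<open>
One of the two points of a pair in \<open>Qset \<Omega>\<close> lies in $\Omega$. Integrating over the other point first
bounds the integral by twice the volume of $\Omega$ times the integral of $\min(|x|^2,1)K(x)$.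
\<close>

lemma integrable_truncated_square: "integrable \<nu> (\<lambda>z. min ((norm (fst z - snd z))\<^sup>2) 1)"
proof -
  define h where "h z = min ((norm (fst z - snd z))\<^sup>2) 1" for z :: "(real^'n) \<times> (real^'n)"
  have "h \<in> borel_measurable borel"
    unfolding h_def by (intro borel_measurable_continuous_onI continuous_intros)
  then have h[measurable]: "h \<in> borel_measurable lebesgue"
    by (intro measurable_completion) simp
  have int: "integrable lebesgue (\<lambda>x. min ((norm x)\<^sup>2) 1 * K x)"
    using kernel unfolding admissible_kernel_def by blast
  obtain k where k[measurable]: "k \<in> borel_measurable borel"
    and "AE x in lborel. min ((norm x)\<^sup>2) 1 * K x = k x"
    using completion_ex_borel_measurable_real[OF borel_measurable_integrable[OF int]] by auto
  then have mK: "AE x in lebesgue. min ((norm x)\<^sup>2) 1 * K x = k x"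
    by (simp add: AE_completion_iff)
  define k' where "k' x = ennreal \<bar>k x\<bar>" for x
  have [measurable]: "k' \<in> borel_measurable borel"
    unfolding k'_def by measurable
  have k_finite: "(\<integral>\<^sup>+x. k' x \<partial>lborel) < \<infinity>"
  proof -
    have "(\<integral>\<^sup>+x. k' x \<partial>lborel) = (\<integral>\<^sup>+x. ennreal (norm (min ((norm x)\<^sup>2) 1 * K x)) \<partial>lebesgue)"
      unfolding k'_def by (rule nn_integral_lborel_cong_lebesgue, rule eventually_mono[OF mK]) simp
    then show ?thesis
      using int by (simp add: integrable_iff_bounded)
  qed
  have dom_finite: "emeasure lborel \<Omega> < \<infinity>"
    by (rule emeasure_bounded_finite[OF bounded_dom])
  have [measurable]: "(\<lambda>z. k' (fst z - snd z)) \<in> borel_measurable (borel \<Otimes>\<^sub>M borel)"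
    by measurable
  have "(\<integral>\<^sup>+z. ennreal (norm (weight z * h z)) \<partial>lebesgue)
      \<le> (\<integral>\<^sup>+z. indicator \<Omega> (fst z) * k' (fst z - snd z) + indicator \<Omega> (snd z) * k' (fst z - snd z) \<partial>lborel)"
  proof -
    have "AE z in lebesgue. ennreal (norm (weight z * h z))
      \<le> indicator \<Omega> (fst z) * k' (fst z - snd z) + indicator \<Omega> (snd z) * k' (fst z - snd z)"
      using AE_lebesgue_diff[OF mK]
    proof eventually_elim
      case (elim z)
      have "h z * \<bar>K (fst z - snd z)\<bar> = \<bar>k (fst z - snd z)\<bar>"
        unfolding elim[symmetric] h_def by (simp add: abs_mult)
      then have "norm (weight z * h z) = indicator (Qset \<Omega>) z * \<bar>k (fst z - snd z)\<bar>"
        by (simp add: weight_def abs_mult h_def mult_ac)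
      then show ?case
        by (cases z) (auto simp: k'_def indicator_def Qset_def)
    qed
    then show ?thesis
      unfolding nn_integral_completion[of lborel] AE_completion_iff by (rule nn_integral_mono_AE)
  qed
  also have "\<dots> = (\<integral>\<^sup>+z. indicator \<Omega> (fst z) * k' (fst z - snd z) \<partial>(lborel \<Otimes>\<^sub>M lborel))
      + (\<integral>\<^sup>+z. indicator \<Omega> (snd z) * k' (fst z - snd z) \<partial>(lborel \<Otimes>\<^sub>M lborel))"
    unfolding lborel_prod[symmetric] by (rule nn_integral_add) measurable
  also have "(\<integral>\<^sup>+z. indicator \<Omega> (fst z) * k' (fst z - snd z) \<partial>(lborel \<Otimes>\<^sub>M lborel))
      = emeasure lborel \<Omega> * (\<integral>\<^sup>+x. k' x \<partial>lborel)"
    by (subst lborel.nn_integral_fst[symmetric])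
       (auto simp: nn_integral_cmult nn_integral_lborel_reflect nn_integral_multc)
  also have "(\<integral>\<^sup>+z. indicator \<Omega> (snd z) * k' (fst z - snd z) \<partial>(lborel \<Otimes>\<^sub>M lborel))
      = emeasure lborel \<Omega> * (\<integral>\<^sup>+x. k' x \<partial>lborel)"
    by (subst lborel_pair.nn_integral_snd[symmetric])
       (auto simp: nn_integral_cmult nn_integral_lborel_translate nn_integral_multc)
  finally have "(\<integral>\<^sup>+z. ennreal (norm (weight z * h z)) \<partial>lebesgue) < \<infinity>"
    using k_finite dom_finite by (simp add: ennreal_mult_less_top less_top order_le_less_trans)
  then have "integrable lebesgue (\<lambda>z. weight z * h z)"
    by (intro integrableI_bounded) auto
  then show ?thesis
    using integrable_\<nu>_iff[OF h] by (simp add: h_def[abs_def])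
qed

text \<open>
The increment is bounded both by the distance of the two points and by one, so its square is below
the integrable function of the previous lemma.
\<close>

lemma tent_function_X0:
  assumes r: "0 < r" "r \<le> 1" and sub: "ball a r \<subseteq> \<Omega>"
  defines "u \<equiv> \<lambda>x. max 0 (r - dist a x)"
  shows "u \<in> X0 K \<Omega>" and "0 < (\<integral>x. (u x)\<^sup>2 \<partial>lebesgue)"
proof -
  have off: "u x = 0" if "x \<notin> \<Omega>" for x
  proof -
    have "x \<notin> ball a r" using that sub by blast
    then show ?thesis by (simp add: u_def)
  qed
  have le1: "0 \<le> u x" "u x \<le> 1" for x
  proof -
    have "r - dist a x \<le> 1" using r zero_le_dist[of a x] by linarith
    then show "0 \<le> u x" "u x \<le> 1" by (auto simp: u_def)
  qed
  have dom_finite: "emeasure lebesgue \<Omega> < \<infinity>"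
    using emeasure_bounded_finite[OF bounded_dom] by simp
  show u: "u \<in> X0 K \<Omega>"
  proof (rule X0_bound)
    show "u \<in> borel_measurable lebesgue"
      unfolding u_def
      by (intro measurable_completion borel_measurable_continuous_onI) (auto intro!: continuous_intros)
    show "AE x in lebesgue. x \<notin> \<Omega> \<longrightarrow> u x = 0"
      using off by simp
    show "integrable lebesgue (indicator \<Omega> :: _ \<Rightarrow> real)"
      using dom_finite by (simp add: integrable_indicator_iff)
    show "(u x)\<^sup>2 \<le> indicator \<Omega> x" for x
      using le1[of x] off[of x] by (auto simp: indicator_def power_le_one)
    show "(increment u z)\<^sup>2 \<le> min ((norm (fst z - snd z))\<^sup>2) 1" for z
    proof -
      have "\<bar>increment u z\<bar> \<le> norm (fst z - snd z)"
        using dist_triangle[of a "fst z" "snd z"] dist_triangle[of a "snd z" "fst z"]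
        by (auto simp: increment_def u_def dist_norm[symmetric] dist_commute)
      moreover have "\<bar>increment u z\<bar> \<le> 1"
        using le1[of "fst z"] le1[of "snd z"] by (auto simp: increment_def)
      ultimately show ?thesis
        using power_mono[of "\<bar>increment u z\<bar>" _ 2] by (auto simp: power_le_one abs_square_le_1)
    qed
  qed (rule integrable_truncated_square)
  have "0 < (r / 2)\<^sup>2 * measure lebesgue (ball a (r / 2))"
    using r by (simp add: content_ball_pos)
  also have "\<dots> = (\<integral>x. (r / 2)\<^sup>2 * indicator (ball a (r / 2)) x \<partial>lebesgue)"
    by simp
  also have "\<dots> \<le> (\<integral>x. (u x)\<^sup>2 \<partial>lebesgue)"
  proof (rule integral_mono)
    show "integrable lebesgue (\<lambda>x. (r / 2)\<^sup>2 * indicator (ball a (r / 2)) x :: real)"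
      using emeasure_lborel_ball_finite[of a "r / 2"] by (simp add: integrable_indicator_iff)
    show "(r / 2)\<^sup>2 * indicator (ball a (r / 2)) x \<le> (u x)\<^sup>2" for x
      using r by (auto simp: indicator_def u_def intro!: power_mono)
  qed (rule X0D(2)[OF u])
  finally show "0 < (\<integral>x. (u x)\<^sup>2 \<partial>lebesgue)" .
qed

text \<open>
Without a nodal pair the set of admissible paths might be empty, and the minimax value
meaningless.
\<close>

lemma nodal_pair_exists: "\<exists>f g. nodal_pair f g"
proof -
  obtain a where "a \<in> \<Omega>" using dom_nonempty by auto
  then obtain R where R: "0 < R" "ball a R \<subseteq> \<Omega>"
    using open_dom open_contains_ball by blast
  define r where "r = min 1 (R / 4)"
  have r: "0 < r" "r \<le> 1" "r \<le> R / 4" using R by (auto simp: r_def)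
  obtain e :: "real^'n" where e: "norm e = R / 2"
    using vector_choose_size[of "R / 2"] R by auto
  define b where "b = a + e"
  have ab: "dist a b = R / 2"
    using e by (simp add: b_def dist_norm)
  have sub: "ball a r \<subseteq> \<Omega>" "ball b r \<subseteq> \<Omega>"
  proof -
    have "ball b r \<subseteq> ball a R"
      using ab r R by (simp add: ball_subset_ball_iff dist_commute)
    then show "ball b r \<subseteq> \<Omega>" using R by blast
    have "ball a r \<subseteq> ball a R"
      using r R by (intro subset_ball) auto
    then show "ball a r \<subseteq> \<Omega>" using R by blast
  qed
  have "max 0 (r - dist a x) * max 0 (r - dist b x) = 0" for x
    using dist_triangle2[of a b x] ab r by (auto simp: max_def)
  then show ?thesis
    using nodal_pair_normalize[OF tent_function_X0(1)[OF r(1,2) sub(1)] _ tent_function_X0(2)[OF r(1,2) sub(1)]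
        tent_function_X0(1)[OF r(1,2) sub(2)] _ tent_function_X0(2)[OF r(1,2) sub(2)]]
    by auto
qed

section \<open>Continuity along paths\<close>

text \<open>
The topology of paths is that of the energy alone; the Poincare inequality turns convergence in
energy into convergence in $L^2$.
\<close>

lemma L2_convergence:
  assumes u: "u \<in> X0 K \<Omega>" and v: "\<And>n. v n \<in> X0 K \<Omega>"
    and lim: "(\<lambda>n. form (\<lambda>x. v n x - u x) (\<lambda>x. v n x - u x)) \<longlonglongrightarrow> 0"
  shows "(\<lambda>n. \<integral>x. (v n x - u x)\<^sup>2 \<partial>lebesgue) \<longlonglongrightarrow> 0"
proof -
  obtain C where C: "\<And>w. w \<in> X0 K \<Omega> \<Longrightarrow> (\<integral>x. (w x)\<^sup>2 \<partial>lebesgue) \<le> C * form w w"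
    using poincare by blast
  show ?thesis
  proof (rule tendsto_sandwich[OF _ _ tendsto_const])
    show "(\<lambda>n. C * form (\<lambda>x. v n x - u x) (\<lambda>x. v n x - u x)) \<longlonglongrightarrow> 0"
      using tendsto_mult_left[OF lim, of C] by simp
    show "\<forall>\<^sub>F n in sequentially. (\<integral>x. (v n x - u x)\<^sup>2 \<partial>lebesgue) \<le> C * form (\<lambda>x. v n x - u x) (\<lambda>x. v n x - u x)"
      using C[OF X0_diff[OF v u]] by simp
  qed simp
qed

lemma AE_convergent_subsequence:
  assumes u: "u \<in> X0 K \<Omega>" and v: "\<And>n. v n \<in> X0 K \<Omega>"
    and lim: "(\<lambda>n. form (\<lambda>x. v n x - u x) (\<lambda>x. v n x - u x)) \<longlonglongrightarrow> 0"
  shows "\<exists>q :: nat \<Rightarrow> nat. strict_mono q \<and> (AE x in lebesgue. (\<lambda>n. v (q n) x) \<longlonglongrightarrow> u x)"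
proof -
  have "\<exists>q :: nat \<Rightarrow> nat. strict_mono q \<and> (AE x in lebesgue. (\<lambda>n. (v (q n) x - u x)\<^sup>2) \<longlonglongrightarrow> 0)"
    by (rule tendsto_L1_AE_subseq) (use X0D(2)[OF X0_diff[OF v u]] L2_convergence[OF u v lim] in auto)
  then obtain q :: "nat \<Rightarrow> nat" where q: "strict_mono q"
    and ae: "AE x in lebesgue. (\<lambda>n. (v (q n) x - u x)\<^sup>2) \<longlonglongrightarrow> 0"
    by blast
  have "AE x in lebesgue. (\<lambda>n. v (q n) x) \<longlonglongrightarrow> u x"
    using ae
  proof eventually_elim
    case (elim x)
    then have "(\<lambda>n. v (q n) x - u x) \<longlonglongrightarrow> 0"
      by (simp add: power_tendsto_0_iff)
    then show ?case
      by (simp add: LIM_zero_iff)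
  qed
  with q show ?thesis by blast
qed

text \<open>
Applied to $\psi(a)=(a^+)^2$, this is the continuity of the mass of the positive part.
\<close>

lemma tendsto_mass:
  fixes \<psi> :: "real \<Rightarrow> real"
  assumes \<psi>: "continuous_on UNIV \<psi>" "\<And>a. 0 \<le> \<psi> a" "\<And>a. \<psi> a \<le> a\<^sup>2"
    and u: "u \<in> X0 K \<Omega>" and v: "\<And>n. v n \<in> X0 K \<Omega>"
    and lim: "(\<lambda>n. form (\<lambda>x. v n x - u x) (\<lambda>x. v n x - u x)) \<longlonglongrightarrow> 0"
  shows "(\<lambda>n. \<integral>x. \<psi> (v n x) \<partial>lebesgue) \<longlonglongrightarrow> (\<integral>x. \<psi> (u x) \<partial>lebesgue)"
proof (rule convergent_subsubsequences_imp_tendsto)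
  fix r :: "nat \<Rightarrow> nat" assume r: "strict_mono r"
  have lim': "(\<lambda>n. form (\<lambda>x. v (r n) x - u x) (\<lambda>x. v (r n) x - u x)) \<longlonglongrightarrow> 0"
    using LIMSEQ_subseq_LIMSEQ[OF lim r] by (simp add: o_def)
  obtain q :: "nat \<Rightarrow> nat" where q: "strict_mono q"
    and ae: "AE x in lebesgue. (\<lambda>n. v (r (q n)) x) \<longlonglongrightarrow> u x"
    using AE_convergent_subsequence[OF u v lim'] by blast
  note [measurable] = borel_measurable_continuous_onI[OF \<psi>(1)] X0D(1)[OF u] X0D(1)[OF v]
  have "(\<lambda>n. \<integral>x. \<psi> (v (r (q n)) x) \<partial>lebesgue) \<longlonglongrightarrow> (\<integral>x. \<psi> (u x) \<partial>lebesgue)"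
  proof (rule tendsto_integral_of_dominated_L1[where h = "\<lambda>x. 2 * (u x)\<^sup>2"
        and e = "\<lambda>n x. 2 * (v (r (q n)) x - u x)\<^sup>2"])
    show "integrable lebesgue (\<lambda>x. 2 * (u x)\<^sup>2)"
      using X0D(2)[OF u] by simp
    show "integrable lebesgue (\<lambda>x. 2 * (v (r (q n)) x - u x)\<^sup>2)" for n
      using X0D(2)[OF X0_diff[OF v u]] by simp
    show "(\<lambda>n. \<integral>x. 2 * (v (r (q n)) x - u x)\<^sup>2 \<partial>lebesgue) \<longlonglongrightarrow> 0"
      using tendsto_mult_left[OF LIMSEQ_subseq_LIMSEQ[OF L2_convergence[OF u v lim'] q], of 2]
      by (simp add: o_def)
    show "\<psi> (v (r (q n)) x) \<le> 2 * (u x)\<^sup>2 + 2 * (v (r (q n)) x - u x)\<^sup>2" for n x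
      using \<psi>(3)[of "v (r (q n)) x"] square_sum_le[of "u x" "v (r (q n)) x - u x"] by simp
    show "AE x in lebesgue. (\<lambda>n. \<psi> (v (r (q n)) x)) \<longlonglongrightarrow> \<psi> (u x)"
      using ae
    proof eventually_elim
      case (elim x)
      then show ?case
        using continuous_on_tendsto_compose[OF \<psi>(1) elim] by simp
    qed
    show "AE x in lebesgue. \<psi> (u x) \<le> 2 * (u x)\<^sup>2"
      using \<psi>(3) by (intro AE_I2) (smt (verit) zero_le_power2)
  qed (use \<psi>(2) in auto)
  then show "\<exists>q. (\<lambda>n. \<integral>x. \<psi> (v (r (q n)) x) \<partial>lebesgue) \<longlonglongrightarrow> (\<integral>x. \<psi> (u x) \<partial>lebesgue)"
    by blast
qed

text \<open>
Applied to $\psi(a,b)=(a-b)(a^+-b^+)$, this is the continuity of $\langle u,u^+\rangle$. The increment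
of $u^+-v^+$ is not controlled by that of $u-v$, so the continuity comes from domination by the
energy density of $u$ instead of an estimate of the difference.
\<close>

lemma tendsto_energy:
  fixes \<psi> :: "real \<times> real \<Rightarrow> real"
  assumes \<psi>: "continuous_on UNIV \<psi>" "\<And>a. 0 \<le> \<psi> a" "\<And>a b. \<psi> (a, b) \<le> (a - b)\<^sup>2"
    and u: "u \<in> X0 K \<Omega>" and v: "\<And>n. v n \<in> X0 K \<Omega>"
    and lim: "(\<lambda>n. form (\<lambda>x. v n x - u x) (\<lambda>x. v n x - u x)) \<longlonglongrightarrow> 0"
  shows "(\<lambda>n. \<integral>z. \<psi> (v n (fst z), v n (snd z)) \<partial>\<nu>) \<longlonglongrightarrow> (\<integral>z. \<psi> (u (fst z), u (snd z)) \<partial>\<nu>)"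
proof (rule convergent_subsubsequences_imp_tendsto)
  fix r :: "nat \<Rightarrow> nat" assume r: "strict_mono r"
  have lim': "(\<lambda>n. form (\<lambda>x. v (r n) x - u x) (\<lambda>x. v (r n) x - u x)) \<longlonglongrightarrow> 0"
    using LIMSEQ_subseq_LIMSEQ[OF lim r] by (simp add: o_def)
  obtain q :: "nat \<Rightarrow> nat" where q: "strict_mono q"
    and ae: "AE x in lebesgue. (\<lambda>n. v (r (q n)) x) \<longlonglongrightarrow> u x"
    using AE_convergent_subsequence[OF u v lim'] by blast
  have meas: "(\<lambda>z. \<psi> (w (fst z), w (snd z))) \<in> borel_measurable \<nu>" if "w \<in> X0 K \<Omega>" for w
  proof -
    have [measurable]: "\<psi> \<in> borel_measurable (borel \<Otimes>\<^sub>M borel)"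
      unfolding borel_prod by (rule borel_measurable_continuous_onI[OF \<psi>(1)])
    have [measurable]: "(\<lambda>z. w (fst z)) \<in> borel_measurable \<nu>" "(\<lambda>z. w (snd z)) \<in> borel_measurable \<nu>"
      unfolding measurable_\<nu>
      by (intro measurable_lebesgue_fst measurable_lebesgue_snd X0D(1)[OF that])+
    show ?thesis by measurable
  qed
  have "(\<lambda>n. \<integral>z. \<psi> (v (r (q n)) (fst z), v (r (q n)) (snd z)) \<partial>\<nu>)
      \<longlonglongrightarrow> (\<integral>z. \<psi> (u (fst z), u (snd z)) \<partial>\<nu>)"
  proof (rule tendsto_integral_of_dominated_L1[where h = "\<lambda>z. 2 * (increment u z)\<^sup>2"
        and e = "\<lambda>n z. 2 * (increment (\<lambda>x. v (r (q n)) x - u x) z)\<^sup>2"])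
    show "integrable \<nu> (\<lambda>z. 2 * (increment u z)\<^sup>2)"
      using X0D(3)[OF u] by simp
    show "integrable \<nu> (\<lambda>z. 2 * (increment (\<lambda>x. v (r (q n)) x - u x) z)\<^sup>2)" for n
      using X0D(3)[OF X0_diff[OF v u]] by simp
    show "(\<lambda>n. \<integral>z. 2 * (increment (\<lambda>x. v (r (q n)) x - u x) z)\<^sup>2 \<partial>\<nu>) \<longlonglongrightarrow> 0"
      using tendsto_mult_left[OF LIMSEQ_subseq_LIMSEQ[OF lim' q], of 2]
      by (simp add: o_def form_self)
    show "\<psi> (v (r (q n)) (fst z), v (r (q n)) (snd z))
        \<le> 2 * (increment u z)\<^sup>2 + 2 * (increment (\<lambda>x. v (r (q n)) x - u x) z)\<^sup>2" for n z
    proof -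
      have "increment u z + increment (\<lambda>x. v (r (q n)) x - u x) z = v (r (q n)) (fst z) - v (r (q n)) (snd z)"
        by (simp add: increment_def)
      then show ?thesis
        using \<psi>(3)[of "v (r (q n)) (fst z)" "v (r (q n)) (snd z)"]
          square_sum_le[of "increment u z" "increment (\<lambda>x. v (r (q n)) x - u x) z"]
        by simp
    qed
    show "AE z in \<nu>. (\<lambda>n. \<psi> (v (r (q n)) (fst z), v (r (q n)) (snd z))) \<longlonglongrightarrow> \<psi> (u (fst z), u (snd z))"
    proof (rule AE_\<nu>)
      show "AE z in lebesgue. (\<lambda>n. \<psi> (v (r (q n)) (fst z), v (r (q n)) (snd z))) \<longlonglongrightarrow> \<psi> (u (fst z), u (snd z))"
        using AE_lebesgue_fst[OF ae] AE_lebesgue_snd[OF ae]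
      proof eventually_elim
        case (elim z)
        then show ?case
          using continuous_on_tendsto_compose[OF \<psi>(1) tendsto_Pair[OF elim]] by simp
      qed
    qed
    show "AE z in \<nu>. \<psi> (u (fst z), u (snd z)) \<le> 2 * (increment u z)\<^sup>2"
    proof (rule AE_I2)
      fix z
      show "\<psi> (u (fst z), u (snd z)) \<le> 2 * (increment u z)\<^sup>2"
        using \<psi>(3)[of "u (fst z)" "u (snd z)"] zero_le_power2[of "increment u z"]
        unfolding increment_def by linarith
    qed
  qed (use \<psi>(2) u v meas in auto)
  then show "\<exists>q. (\<lambda>n. \<integral>z. \<psi> (v (r (q n)) (fst z), v (r (q n)) (snd z)) \<partial>\<nu>)
      \<longlonglongrightarrow> (\<integral>z. \<psi> (u (fst z), u (snd z)) \<partial>\<nu>)"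
    by blast
qed

lemma Gamma_paths_X0:
  "\<gamma> \<in> Gamma_paths K \<Omega> \<phi> \<Longrightarrow> t \<in> {-1..1} \<Longrightarrow> \<gamma> t \<in> X0 K \<Omega>"
  by (auto simp: Gamma_paths_def Psphere_iff)

lemma Gamma_paths_tendsto:
  assumes \<gamma>: "\<gamma> \<in> Gamma_paths K \<Omega> \<phi>" and t: "t \<in> {-1..1}" and X: "\<And>n. X n \<in> {-1..1}" "X \<longlonglongrightarrow> t"
  shows "(\<lambda>n. form (\<lambda>x. \<gamma> (X n) x - \<gamma> t x) (\<lambda>x. \<gamma> (X n) x - \<gamma> t x)) \<longlonglongrightarrow> 0"
proof -
  have "((\<lambda>t'. X0_norm K \<Omega> (\<lambda>x. \<gamma> t' x - \<gamma> t x)) \<longlongrightarrow> 0) (at t within {-1..1})"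
    using \<gamma> t by (auto simp: Gamma_paths_def)
  moreover have "X0_norm K \<Omega> (\<lambda>x. \<gamma> t x - \<gamma> t x) = 0"
    by (simp add: X0_norm_def set_lebesgue_integral_def)
  ultimately have "continuous (at t within {-1..1}) (\<lambda>t'. X0_norm K \<Omega> (\<lambda>x. \<gamma> t' x - \<gamma> t x))"
    by (simp add: continuous_within)
  then have "(\<lambda>n. X0_norm K \<Omega> (\<lambda>x. \<gamma> (X n) x - \<gamma> t x)) \<longlonglongrightarrow> X0_norm K \<Omega> (\<lambda>x. \<gamma> t x - \<gamma> t x)"
    by (rule continuous_within_tendsto_compose) (use X in auto)
  then have "(\<lambda>n. (X0_norm K \<Omega> (\<lambda>x. \<gamma> (X n) x - \<gamma> t x))\<^sup>2) \<longlonglongrightarrow> 0\<^sup>2"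
    unfolding \<open>X0_norm K \<Omega> (\<lambda>x. \<gamma> t x - \<gamma> t x) = 0\<close> by (rule tendsto_power)
  moreover have "(X0_norm K \<Omega> (\<lambda>x. \<gamma> (X n) x - \<gamma> t x))\<^sup>2 = form (\<lambda>x. \<gamma> (X n) x - \<gamma> t x) (\<lambda>x. \<gamma> (X n) x - \<gamma> t x)" for n
    by (rule X0_norm_sq[OF X0D(1)[OF X0_diff]]) (use Gamma_paths_X0[OF \<gamma>] X t in auto)
  ultimately show ?thesis
    by simp
qed

lemma continuous_on_path_mass:
  fixes \<psi> :: "real \<Rightarrow> real"
  assumes "\<gamma> \<in> Gamma_paths K \<Omega> \<phi>"
    and "continuous_on UNIV \<psi>" "\<And>a. 0 \<le> \<psi> a" "\<And>a. \<psi> a \<le> a\<^sup>2"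
  shows "continuous_on {-1..1} (\<lambda>t. \<integral>x. \<psi> (\<gamma> t x) \<partial>lebesgue)"
  unfolding continuous_on_sequentially o_def
  by (auto intro!: tendsto_mass[OF assms(2-4)] Gamma_paths_tendsto[OF assms(1)] Gamma_paths_X0[OF assms(1)])

lemma continuous_on_path_energy:
  fixes \<psi> :: "real \<times> real \<Rightarrow> real"
  assumes "\<gamma> \<in> Gamma_paths K \<Omega> \<phi>"
    and "continuous_on UNIV \<psi>" "\<And>a. 0 \<le> \<psi> a" "\<And>a b. \<psi> (a, b) \<le> (a - b)\<^sup>2"
  shows "continuous_on {-1..1} (\<lambda>t. \<integral>z. \<psi> (\<gamma> t (fst z), \<gamma> t (snd z)) \<partial>\<nu>)"
  unfolding continuous_on_sequentially o_def
  by (auto intro!: tendsto_energy[OF assms(2-4)] Gamma_paths_tendsto[OF assms(1)] Gamma_paths_X0[OF assms(1)])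

lemma continuous_on_Jfun:
  assumes \<gamma>: "\<gamma> \<in> Gamma_paths K \<Omega> \<phi>"
  shows "continuous_on {-1..1} (\<lambda>t. Jfun K \<Omega> p (\<gamma> t))"
proof -
  have E: "continuous_on {-1..1} (\<lambda>t. \<integral>z. (\<lambda>(a, b). (a - b)\<^sup>2) (\<gamma> t (fst z), \<gamma> t (snd z)) \<partial>\<nu>)"
    by (rule continuous_on_path_energy[OF \<gamma>]) (auto simp: case_prod_beta intro!: continuous_intros)
  have a: "continuous_on {-1..1} (\<lambda>t. \<integral>x. (max (\<gamma> t x) 0)\<^sup>2 \<partial>lebesgue)"
    by (rule continuous_on_path_mass[OF \<gamma>]) (intro continuous_intros, simp, simp add: max_def)
  have "Jfun K \<Omega> p (\<gamma> t) = (\<integral>z. (\<lambda>(a, b). (a - b)\<^sup>2) (\<gamma> t (fst z), \<gamma> t (snd z)) \<partial>\<nu>)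
      - p * (\<integral>x. (max (\<gamma> t x) 0)\<^sup>2 \<partial>lebesgue)" if "t \<in> {-1..1}" for t
    using Jfun_eq[OF Gamma_paths_X0[OF \<gamma> that]] by (simp add: form_self increment_def)
  then show ?thesis
    using continuous_on_diff[OF E continuous_on_mult_left[OF a, of p]]
    by (subst continuous_on_cong[OF refl]) auto
qed

section \<open>Every path meets a balanced pair\<close>

text \<open>
No eigenvalue of the matrix with diagonal \<open>form f f - p\<close>, \<open>form g g\<close> and off-diagonal entry
\<open>- form f g\<close> exceeds \<open>m\<close>: the difference of \<open>m\<close> times the identity and this matrix has
nonnegative diagonal and determinant.
\<close>

definition top_eigenvalue_le :: "real \<Rightarrow> real \<Rightarrow> (real^'n \<Rightarrow> real) \<Rightarrow> (real^'n \<Rightarrow> real) \<Rightarrow> bool" where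
  "top_eigenvalue_le p m f g \<longleftrightarrow> form f f - p \<le> m \<and> form g g \<le> m \<and>
     (form f g)\<^sup>2 \<le> (m - (form f f - p)) * (m - form g g)"

text \<open>
Write $A,B,D$ for the energies and the interaction of $u^+$ and $u^-$, and $\alpha,\beta$ for their
masses. Then $J_p(u)-m<0$ is the sum of \<open>h\<close> $=A+D-(p+m)\alpha$ and $B+D-m\beta$. At $-\phi_1$ the first
summand is zero, at $\phi_1$ the second. By continuity they are equal somewhere in between, and both
are negative there. This forces $\alpha,\beta>0$, and multiplying $D<(p+m)\alpha-A$ by $D<m\beta-B$ gives
the condition on the determinant.
\<close>

lemma nodal_pair_below_path:
  assumes \<phi>: "nonneg_minimizer K \<Omega> \<phi>" and \<gamma>: "\<gamma> \<in> Gamma_paths K \<Omega> \<phi>"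
    and below: "\<And>t. t \<in> {-1..1} \<Longrightarrow> Jfun K \<Omega> p (\<gamma> t) < m"
  shows "\<exists>f g. nodal_pair f g \<and> top_eigenvalue_le p m f g"
proof -
  define a where "a t = (\<integral>x. (max (\<gamma> t x) 0)\<^sup>2 \<partial>lebesgue)" for t
  define \<psi> :: "real \<times> real \<Rightarrow> real" where "\<psi> r = (fst r - snd r) * (max (fst r) 0 - max (snd r) 0)" for r
  define e where "e t = (\<integral>z. \<psi> (\<gamma> t (fst z), \<gamma> t (snd z)) \<partial>\<nu>)" for t
  define h where "h t = e t - (p + m) * a t" for t
  define \<sigma> where "\<sigma> t = Jfun K \<Omega> p (\<gamma> t) - m" for t
  have \<sigma>_neg: "\<sigma> t < 0" if "t \<in> {-1..1}" for t
    using below[OF that] by (simp add: \<sigma>_def)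
  have X0: "\<gamma> t \<in> X0 K \<Omega>" if "t \<in> {-1..1}" for t
    by (rule Gamma_paths_X0[OF \<gamma> that])
  have mass: "(\<integral>x. (\<gamma> t x)\<^sup>2 \<partial>lebesgue) = 1" if "t \<in> {-1..1}" for t
    using \<gamma> that by (auto simp: Gamma_paths_def Psphere_iff)
  have "continuous_on {-1..1} a"
    unfolding a_def by (rule continuous_on_path_mass[OF \<gamma>]) (intro continuous_intros, simp, simp add: max_def)
  moreover have "continuous_on {-1..1} e"
    unfolding e_def
  proof (rule continuous_on_path_energy[OF \<gamma>])
    show "continuous_on UNIV \<psi>"
      unfolding \<psi>_def by (intro continuous_intros)
    show "0 \<le> \<psi> r" for r
      by (auto simp: \<psi>_def max_def zero_le_mult_iff)
    show "\<psi> (r, q) \<le> (r - q)\<^sup>2" for r q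
      unfolding \<psi>_def power2_eq_square fst_conv snd_conv
      by (cases "q \<le> r"; rule mult_left_mono mult_left_mono_neg) (auto simp: max_def)
  qed
  moreover have "continuous_on {-1..1} \<sigma>"
    unfolding \<sigma>_def by (intro continuous_intros continuous_on_Jfun[OF \<gamma>])
  ultimately have cont: "continuous_on {-1..1} (\<lambda>t. h t - \<sigma> t / 2)"
    unfolding h_def by (intro continuous_intros) auto
  have \<phi>_nonneg: "AE x in lebesgue. 0 \<le> \<phi> x"
    using \<phi> by (auto simp: nonneg_minimizer_def)
  have h_left: "h (-1) = 0"
  proof -
    have neg: "AE x in lebesgue. \<gamma> (-1) x \<le> 0"
      using \<phi>_nonneg \<gamma> by (auto simp: Gamma_paths_def)
    have "AE x in lebesgue. (max (\<gamma> (-1) x) 0)\<^sup>2 = 0"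
      by (rule eventually_mono[OF neg]) simp
    then have "a (-1) = 0"
      unfolding a_def by (rule integral_eq_zero_AE)
    moreover have "AE z in \<nu>. \<psi> (\<gamma> (-1) (fst z), \<gamma> (-1) (snd z)) = 0"
      by (rule AE_\<nu>, rule eventually_mono[OF eventually_conj[OF AE_lebesgue_fst[OF neg] AE_lebesgue_snd[OF neg]]])
         (simp add: \<psi>_def)
    then have "e (-1) = 0"
      unfolding e_def by (rule integral_eq_zero_AE)
    ultimately show ?thesis by (simp add: h_def)
  qed
  have h_right: "h 1 = \<sigma> 1"
  proof -
    have pos: "AE x in lebesgue. 0 \<le> \<gamma> 1 x"
    proof -
      have "AE x in lebesgue. \<gamma> 1 x = \<phi> x"
        using \<gamma> by (auto simp: Gamma_paths_def)
      with \<phi>_nonneg show ?thesis by eventually_elim simp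
    qed
    note [measurable] = X0D(1)[OF X0[of 1, simplified]] X0D(5)[OF X0[of 1, simplified]]
      X0D(5)[OF X0_truncate(1)[OF X0[of 1, simplified]]]
    have "a 1 = (\<integral>x. (\<gamma> 1 x)\<^sup>2 \<partial>lebesgue)"
      unfolding a_def
      by (rule integral_cong_AE, measurable, rule eventually_mono[OF pos]) simp
    moreover have "e 1 = form (\<gamma> 1) (\<gamma> 1)"
    proof -
      have "e 1 = (\<integral>z. increment (\<gamma> 1) z * increment (\<lambda>x. max (\<gamma> 1 x) 0) z \<partial>\<nu>)"
        by (simp add: e_def \<psi>_def increment_def)
      also have "\<dots> = form (\<gamma> 1) (\<gamma> 1)"
        unfolding form_def
      proof (rule integral_cong_AE)
        show "AE z in \<nu>. increment (\<gamma> 1) z * increment (\<lambda>x. max (\<gamma> 1 x) 0) z = increment (\<gamma> 1) z * increment (\<gamma> 1) z"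
          by (rule AE_\<nu>, rule eventually_mono[OF eventually_conj[OF AE_lebesgue_fst[OF pos] AE_lebesgue_snd[OF pos]]])
             (simp add: increment_def)
      qed measurable
      finally show ?thesis .
    qed
    ultimately show ?thesis
      using mass[of 1] Jfun_eq[OF X0[of 1]] by (simp add: h_def \<sigma>_def a_def algebra_simps)
  qed
  \<comment> \<open>The two summands \<open>h\<close> and \<open>\<sigma> - h\<close> are equal where \<open>h = \<sigma> / 2\<close>.\<close>
  have "\<exists>t. -1 \<le> t \<and> t \<le> 1 \<and> h t - \<sigma> t / 2 = 0"
    using h_left h_right \<sigma>_neg[of 1] \<sigma>_neg[of "-1"] by (intro IVT2' cont) auto
  then obtain t where t: "t \<in> {-1..1}" and ht: "h t = \<sigma> t / 2"
    by auto
  define u where "u = \<gamma> t"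
  have u: "u \<in> X0 K \<Omega>" "(\<integral>x. (u x)\<^sup>2 \<partial>lebesgue) = 1"
    using X0[OF t] mass[OF t] by (auto simp: u_def)
  define v where "v x = max (u x) 0" for x
  define w where "w x = max (- u x) 0" for x
  have vw: "v \<in> X0 K \<Omega>" "w \<in> X0 K \<Omega>" "\<And>x. 0 \<le> v x" "\<And>x. 0 \<le> w x" "\<And>x. v x * w x = 0"
    using X0_truncate[OF u(1)] by (auto simp: v_def[abs_def] w_def[abs_def] max_def)
  define A B D where "A = form v v" and "B = form w w" and "D = - form v w"
  define \<alpha> \<beta> where "\<alpha> = (\<integral>x. (v x)\<^sup>2 \<partial>lebesgue)" and "\<beta> = (\<integral>x. (w x)\<^sup>2 \<partial>lebesgue)"
  have nonneg: "0 \<le> A" "0 \<le> B" "0 \<le> D" "0 \<le> \<alpha>" "0 \<le> \<beta>"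
    using form_disjoint_nonpos[OF vw(3-5)] by (auto simp: A_def B_def D_def \<alpha>_def \<beta>_def form_self_nonneg)
  have inc: "increment u z = increment v z - increment w z" for z
    by (auto simp: increment_def v_def w_def max_def)
  note int = integrable_increment_mult[OF vw(1) vw(1)] integrable_increment_mult[OF vw(1) vw(2)]
    integrable_increment_mult[OF vw(2) vw(2)]
  have "(u x)\<^sup>2 = (v x)\<^sup>2 + (w x)\<^sup>2" for x
    by (auto simp: v_def w_def max_def)
  then have sum: "\<alpha> + \<beta> = 1"
    using u(2) X0D(2)[OF vw(1)] X0D(2)[OF vw(2)] by (simp add: \<alpha>_def \<beta>_def)
  have E: "form u u = A + B + 2 * D"
  proof -
    have "increment u z * increment u z = increment v z * increment v z + increment w z * increment w z
        - 2 * (increment v z * increment w z)" for z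
      unfolding inc by (simp add: algebra_simps)
    then have "form u u = form v v + form w w - 2 * form v w"
      using int by (simp add: form_def)
    then show ?thesis by (simp add: A_def B_def D_def)
  qed
  have e: "e t = A + D"
  proof -
    have "\<psi> (\<gamma> t (fst z), \<gamma> t (snd z)) = increment v z * increment v z - increment v z * increment w z" for z
    proof -
      have "\<psi> (\<gamma> t (fst z), \<gamma> t (snd z)) = increment u z * increment v z"
        by (simp add: \<psi>_def increment_def u_def v_def)
      then show ?thesis
        unfolding inc by (simp add: algebra_simps)
    qed
    then have "e t = form v v - form v w"
      using int by (simp add: form_def e_def)
    then show ?thesis by (simp add: A_def D_def)
  qed
  have at: "a t = \<alpha>"
    by (simp add: a_def \<alpha>_def u_def v_def)
  have J: "Jfun K \<Omega> p (\<gamma> t) = A + B + 2 * D - p * \<alpha>"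
    using Jfun_eq[OF X0[OF t]] E at by (simp add: u_def a_def)
  have row1: "A + D < (p + m) * \<alpha>"
    using ht \<sigma>_neg[OF t] by (simp add: h_def e at)
  have row2: "B + D < m * \<beta>"
  proof -
    have "\<sigma> t - h t < 0" using ht \<sigma>_neg[OF t] by simp
    then have "B + D + m * \<alpha> - m < 0"
      by (simp add: \<sigma>_def h_def e at J algebra_simps)
    moreover have "m = m * \<alpha> + m * \<beta>"
      using sum by (simp flip: distrib_left)
    ultimately show ?thesis by linarith
  qed
  have pos: "0 < \<alpha>" "0 < \<beta>"
  proof -
    have "\<alpha> \<noteq> 0" using row1 nonneg by auto
    moreover have "\<beta> \<noteq> 0" using row2 nonneg by auto
    ultimately show "0 < \<alpha>" "0 < \<beta>" using nonneg by auto
  qed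
  define f where "f x = 1 / sqrt \<alpha> * v x" for x
  define g where "g x = 1 / sqrt \<beta> * w x" for x
  have "nodal_pair f g"
    using nodal_pair_normalize[OF vw(1,3) _ vw(2,4) _ vw(5)] pos
    by (simp add: f_def[abs_def] g_def[abs_def] \<alpha>_def \<beta>_def)
  moreover have "top_eigenvalue_le p m f g"
  proof -
    have ff: "form f f = A / \<alpha>" and gg: "form g g = B / \<beta>" and fg: "form f g = - D / (sqrt \<alpha> * sqrt \<beta>)"
      unfolding f_def[abs_def] g_def[abs_def] form_scale A_def B_def D_def using pos by simp_all
    have "D * D \<le> ((p + m) * \<alpha> - A) * (m * \<beta> - B)"
      using row1 row2 nonneg by (intro mult_mono) auto
    also have "\<dots> = (m - (A / \<alpha> - p)) * (m - B / \<beta>) * (\<alpha> * \<beta>)"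
      using pos by (simp add: field_simps)
    finally have "D\<^sup>2 / (\<alpha> * \<beta>) \<le> (m - (A / \<alpha> - p)) * (m - B / \<beta>)"
      using pos by (simp add: pos_divide_le_eq power2_eq_square)
    moreover have "(form f g)\<^sup>2 = D\<^sup>2 / (\<alpha> * \<beta>)"
      using pos by (simp add: fg power_divide power_mult_distrib)
    moreover have "A / \<alpha> - p \<le> m"
    proof -
      have "A / \<alpha> \<le> p + m" using row1 nonneg pos by (simp add: pos_divide_le_eq)
      then show ?thesis by simp
    qed
    moreover have "B / \<beta> \<le> m"
      using row2 nonneg pos by (simp add: pos_divide_le_eq)
    ultimately show ?thesis
      by (simp add: top_eigenvalue_le_def ff gg)
  qed
  ultimately show ?thesis by blast
qed

section \<open>Every pair gives a path\<close>

lemma nodal_path_X0: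
  assumes "f \<in> X0 K \<Omega>" "g \<in> X0 K \<Omega>" "\<phi> \<in> X0 K \<Omega>" "t \<in> {-1..1}"
  shows "nodal_path f g \<phi> t \<in> X0 K \<Omega>"
proof (rule X0_bound[OF _ _ _ nodal_path_bounds(1) _ nodal_path_bounds(2)])
  show "nodal_path f g \<phi> t \<in> borel_measurable lebesgue"
    unfolding nodal_path_def[abs_def] using X0D(1)[OF assms(1)] X0D(1)[OF assms(2)] X0D(1)[OF assms(3)]
    by measurable
  show "AE x in lebesgue. x \<notin> \<Omega> \<longrightarrow> nodal_path f g \<phi> t x = 0"
    using X0D(4)[OF assms(1)] X0D(4)[OF assms(2)] X0D(4)[OF assms(3)]
    by eventually_elim (simp add: nodal_path_def)
qed (use X0D(2,3)[OF assms(1)] X0D(2,3)[OF assms(2)] X0D(2,3)[OF assms(3)] assms(4) in auto)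

text \<open>
The path is continuous in \<open>t\<close> at every point of space, and its increments have a common
majorant, so dominated convergence applies.
\<close>

lemma nodal_path_continuous:
  assumes X0: "f \<in> X0 K \<Omega>" "g \<in> X0 K \<Omega>" "\<phi> \<in> X0 K \<Omega>" and t: "t \<in> {-1..1}"
  shows "((\<lambda>t'. X0_norm K \<Omega> (\<lambda>x. nodal_path f g \<phi> t' x - nodal_path f g \<phi> t x)) \<longlongrightarrow> 0) (at t within {-1..1})"
  unfolding tendsto_at_iff_sequentially
proof (intro allI impI)
  fix X :: "nat \<Rightarrow> real" assume X: "\<forall>i. X i \<in> {-1..1} - {t}" "X \<longlonglongrightarrow> t"
  then have Xin: "X n \<in> {-1..1}" for n by auto
  define dw where "dw n = (\<lambda>x. nodal_path f g \<phi> (X n) x - nodal_path f g \<phi> t x)" for n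
  have dw_X0: "dw n \<in> X0 K \<Omega>" for n
    unfolding dw_def by (intro X0_diff nodal_path_X0 X0 t Xin)
  define H where "H z = 2 * ((increment f z)\<^sup>2 + (increment \<phi> z)\<^sup>2) + 2 * ((increment g z)\<^sup>2 + (increment \<phi> z)\<^sup>2)" for z
  have H: "integrable \<nu> (\<lambda>z. 4 * H z)"
    unfolding H_def using X0D(3)[OF X0(1)] X0D(3)[OF X0(2)] X0D(3)[OF X0(3)] by simp
  have "(\<lambda>n. \<integral>z. (increment (dw n) z)\<^sup>2 \<partial>\<nu>) \<longlonglongrightarrow> (\<integral>z. 0 \<partial>\<nu>)"
  proof (rule integral_dominated_convergence[OF _ _ H])
    show "(\<lambda>z. (increment (dw n) z)\<^sup>2) \<in> borel_measurable \<nu>" for n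
      using X0D(3)[OF dw_X0] by (rule borel_measurable_integrable)
    show "AE z in \<nu>. (\<lambda>n. (increment (dw n) z)\<^sup>2) \<longlonglongrightarrow> 0"
    proof (rule AE_I2)
      fix z
      have "(\<lambda>n. dw n x) \<longlonglongrightarrow> 0" for x
        unfolding dw_def
        by (rule LIM_zero, rule continuous_on_tendsto_compose[OF continuous_on_nodal_path X(2)]) auto
      then have "(\<lambda>n. (dw n (fst z) - dw n (snd z))\<^sup>2) \<longlonglongrightarrow> (0 - 0)\<^sup>2"
        by (intro tendsto_intros)
      then show "(\<lambda>n. (increment (dw n) z)\<^sup>2) \<longlonglongrightarrow> 0"
        by (simp add: increment_def)
    qed
    show "AE z in \<nu>. norm ((increment (dw n) z)\<^sup>2) \<le> 4 * H z" for n
    proof (rule AE_I2)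
      fix z
      have "increment (dw n) z = increment (nodal_path f g \<phi> (X n)) z + - increment (nodal_path f g \<phi> t) z"
        by (simp add: increment_def dw_def)
      then show "norm ((increment (dw n) z)\<^sup>2) \<le> 4 * H z"
        using square_sum_le[of "increment (nodal_path f g \<phi> (X n)) z" "- increment (nodal_path f g \<phi> t) z"]
          nodal_path_bounds(2)[OF Xin, of f g \<phi> n z] nodal_path_bounds(2)[OF t, of f g \<phi> z]
        unfolding H_def by simp
    qed
  qed auto
  then have "(\<lambda>n. sqrt (form (dw n) (dw n))) \<longlonglongrightarrow> sqrt 0"
    by (intro tendsto_intros) (simp add: form_self)
  moreover have "X0_norm K \<Omega> (dw n) = sqrt (form (dw n) (dw n))" for n
    by (rule X0_norm_eq[OF X0D(1)[OF dw_X0]])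
  ultimately show "((\<lambda>t'. X0_norm K \<Omega> (\<lambda>x. nodal_path f g \<phi> t' x - nodal_path f g \<phi> t x)) \<circ> X) \<longlonglongrightarrow> 0"
    by (simp add: o_def dw_def)
qed

lemma sqrt_combination:
  assumes u: "u \<in> Psphere K \<Omega>" and v: "v \<in> Psphere K \<Omega>"
    and \<alpha>\<beta>: "0 \<le> \<alpha>" "0 \<le> \<beta>" "\<alpha> + \<beta> = 1" and w: "w \<in> X0 K \<Omega>"
    and w_def: "w = (\<lambda>x. sqrt (\<alpha> * (u x)\<^sup>2 + \<beta> * (v x)\<^sup>2))"
  shows "(\<integral>x. (w x)\<^sup>2 \<partial>lebesgue) = 1" and "form w w \<le> \<alpha> * form u u + \<beta> * form v v"
proof -
  have X0: "u \<in> X0 K \<Omega>" "v \<in> X0 K \<Omega>" 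
    and mass: "(\<integral>x. (u x)\<^sup>2 \<partial>lebesgue) = 1" "(\<integral>x. (v x)\<^sup>2 \<partial>lebesgue) = 1"
    using u v by (auto simp: Psphere_iff)
  have "(w x)\<^sup>2 = \<alpha> * (u x)\<^sup>2 + \<beta> * (v x)\<^sup>2" for x
    using \<alpha>\<beta> by (simp add: w_def)
  then show "(\<integral>x. (w x)\<^sup>2 \<partial>lebesgue) = 1"
    using X0D(2)[OF X0(1)] X0D(2)[OF X0(2)] mass \<alpha>\<beta> by simp
  have "(\<integral>z. (increment w z)\<^sup>2 \<partial>\<nu>) \<le> (\<integral>z. \<alpha> * (increment u z)\<^sup>2 + \<beta> * (increment v z)\<^sup>2 \<partial>\<nu>)"
  proof (rule integral_mono[OF X0D(3)[OF w]])
    show "(increment w z)\<^sup>2 \<le> \<alpha> * (increment u z)\<^sup>2 + \<beta> * (increment v z)\<^sup>2" for z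
      unfolding w_def by (rule sqrt_increment[OF \<alpha>\<beta>(1,2)])
  qed (use X0D(3)[OF X0(1)] X0D(3)[OF X0(2)] in auto)
  then show "form w w \<le> \<alpha> * form u u + \<beta> * form v v"
    using X0D(3)[OF X0(1)] X0D(3)[OF X0(2)] by (simp add: form_self)
qed

text \<open>
On the outer pieces hidden convexity bounds the energy by that of \<open>f\<close> or \<open>g\<close>, as \<open>\<phi>\<close> has the
smallest energy of all; the positive part has mass one on the right piece and zero on the left.
On the middle piece the functional is the quadratic form of the matrix of the pair.
\<close>

lemma nodal_path_below:
  assumes fg: "nodal_pair f g" and \<phi>: "nonneg_minimizer K \<Omega> \<phi>" and lev: "top_eigenvalue_le p m f g"
    and t: "t \<in> {-1..1}"
  shows "nodal_path f g \<phi> t \<in> Psphere K \<Omega>" and "Jfun K \<Omega> p (nodal_path f g \<phi> t) \<le> m"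
proof -
  let ?w = "nodal_path f g \<phi> t"
  have X0: "f \<in> X0 K \<Omega>" "g \<in> X0 K \<Omega>" "\<phi> \<in> X0 K \<Omega>"
    and nonneg: "\<And>x. 0 \<le> f x" "\<And>x. 0 \<le> g x" and disj: "\<And>x. f x * g x = 0"
    and mass: "(\<integral>x. (f x)\<^sup>2 \<partial>lebesgue) = 1" "(\<integral>x. (g x)\<^sup>2 \<partial>lebesgue) = 1"
    using fg \<phi> by (auto simp: nodal_pair_def nonneg_minimizer_def Psphere_iff)
  have sphere: "f \<in> Psphere K \<Omega>" "g \<in> Psphere K \<Omega>" "\<phi> \<in> Psphere K \<Omega>"
    using X0 mass \<phi> by (auto simp: Psphere_iff nonneg_minimizer_def)
  have \<phi>_min: "form \<phi> \<phi> \<le> form f f" "form \<phi> \<phi> \<le> form g g"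
    using lambda1_le[OF sphere(1)] lambda1_le[OF sphere(2)] \<phi>
    by (auto simp: nonneg_minimizer_def X0_norm_sq[OF X0D(1)[OF X0(3)]])
  have w: "?w \<in> X0 K \<Omega>"
    by (rule nodal_path_X0[OF X0 t])
  have "(\<integral>x. (?w x)\<^sup>2 \<partial>lebesgue) = 1 \<and> form ?w ?w - p * (\<integral>x. (max (?w x) 0)\<^sup>2 \<partial>lebesgue) \<le> m"
    using t
  proof (cases rule: weights_cases)
    case right
    then have eq: "?w = (\<lambda>x. sqrt (tent_weight t * (f x)\<^sup>2 + ramp_weight t * (\<phi> x)\<^sup>2))"
      by (simp add: nodal_path_def[abs_def])
    note comb = sqrt_combination[OF sphere(1,3) weights_nonneg right(3) w eq]
    have "max (?w x) 0 = ?w x" for x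
      by (simp add: eq weights_nonneg)
    moreover have "form ?w ?w \<le> form f f"
    proof -
      have "tent_weight t * form f f + ramp_weight t * form \<phi> \<phi> \<le> (tent_weight t + ramp_weight t) * form f f"
        unfolding distrib_right using \<phi>_min weights_nonneg by (intro add_mono mult_left_mono) auto
      then show ?thesis using comb(2) right(3) by simp
    qed
    ultimately show ?thesis
      using comb(1) lev by (simp add: top_eigenvalue_le_def)
  next
    case left
    let ?n = "\<lambda>x. sqrt (tent_weight (- t) * (g x)\<^sup>2 + ramp_weight (- t) * (\<phi> x)\<^sup>2)"
    have eq: "?w = (\<lambda>x. - 1 * ?n x)"
      using left by (simp add: nodal_path_def[abs_def])
    have n: "?n \<in> X0 K \<Omega>"
      using X0_scale[OF w, of "- 1"] eq by simp
    note comb = sqrt_combination[OF sphere(2,3) weights_nonneg left(3) n refl]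
    have "(max (?w x) 0)\<^sup>2 = 0" for x
      by (simp add: eq weights_nonneg)
    moreover have "form ?n ?n \<le> form g g"
    proof -
      have "tent_weight (- t) * form g g + ramp_weight (- t) * form \<phi> \<phi> \<le> (tent_weight (- t) + ramp_weight (- t)) * form g g"
        unfolding distrib_right using \<phi>_min weights_nonneg by (intro add_mono mult_left_mono) auto
      then show ?thesis using comb(2) left(3) by simp
    qed
    moreover have "form ?w ?w = form ?n ?n" 
      unfolding eq form_scale by simp
    moreover have "(?w x)\<^sup>2 = (?n x)\<^sup>2" for x
      unfolding eq by simp
    ultimately show ?thesis
      using comb(1) lev by (simp add: top_eigenvalue_le_def)
  next
    case middle
    define a b where "a = sqrt (tent_weight t)" and "b = sqrt (tent_weight (- t))"
    have ab: "0 \<le> a" "0 \<le> b" "a\<^sup>2 + b\<^sup>2 = 1"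
      using middle(3) by (auto simp: a_def b_def weights_nonneg)
    have eq: "?w x = a * f x - b * g x" for x
      using middle nonneg[of x] by (simp add: nodal_path_def real_sqrt_mult a_def b_def)
    have "max (?w x) 0 = a * f x" for x
      using disj[of x] mult_nonneg_nonneg[OF ab(1) nonneg(1)[of x]] mult_nonneg_nonneg[OF ab(2) nonneg(2)[of x]]
      by (auto simp: eq max_absorb1 max_absorb2)
    then have pos: "(max (?w x) 0)\<^sup>2 = a\<^sup>2 * (f x)\<^sup>2" for x
      by (simp add: power_mult_distrib)
    have sq: "(?w x)\<^sup>2 = a\<^sup>2 * (f x)\<^sup>2 + b\<^sup>2 * (g x)\<^sup>2" for x
      using disj[of x] by (auto simp: eq power_mult_distrib)
    have "(\<integral>x. (?w x)\<^sup>2 \<partial>lebesgue) = 1"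
      unfolding sq using X0D(2)[OF X0(1)] X0D(2)[OF X0(2)] mass ab by simp
    moreover have plus: "(\<integral>x. (max (?w x) 0)\<^sup>2 \<partial>lebesgue) = a\<^sup>2"
      unfolding pos using mass by simp
    have "form ?w ?w = a\<^sup>2 * form f f + b\<^sup>2 * form g g + 2 * (a * b) * (- form f g)"
    proof -
      have "increment ?w z * increment ?w z = a\<^sup>2 * (increment f z * increment f z)
          + b\<^sup>2 * (increment g z * increment g z) - 2 * (a * b) * (increment f z * increment g z)" for z
        by (simp add: increment_def eq power2_eq_square algebra_simps)
      then show ?thesis
        using integrable_increment_mult[OF X0(1) X0(1)] integrable_increment_mult[OF X0(2) X0(2)]
          integrable_increment_mult[OF X0(1) X0(2)]
        by (simp add: form_def)
    qed
    moreover have "2 * (a * b) * (- form f g) \<le> a\<^sup>2 * (m - (form f f - p)) + b\<^sup>2 * (m - form g g)"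
      using lev by (intro weighted_amgm) (auto simp: top_eigenvalue_le_def)
    moreover have "a\<^sup>2 * m + b\<^sup>2 * m = m"
      using ab(3) by (simp flip: distrib_right)
    ultimately show ?thesis
      unfolding plus by (simp add: algebra_simps)
  qed
  then show "?w \<in> Psphere K \<Omega>" "Jfun K \<Omega> p ?w \<le> m"
    using w by (auto simp: Psphere_iff Jfun_eq)
qed

lemma nodal_path_Gamma:
  assumes fg: "nodal_pair f g" and \<phi>: "nonneg_minimizer K \<Omega> \<phi>"
  shows "nodal_path f g \<phi> \<in> Gamma_paths K \<Omega> \<phi>"
proof -
  have X0: "f \<in> X0 K \<Omega>" "g \<in> X0 K \<Omega>" "\<phi> \<in> X0 K \<Omega>"
    using fg \<phi> by (auto simp: nodal_pair_def nonneg_minimizer_def Psphere_iff)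
  \<comment> \<open>Some bound for the eigenvalues suffices, as the path does not depend on \<open>p\<close> and \<open>m\<close>.\<close>
  have "top_eigenvalue_le 0 (form f f + form g g + \<bar>form f g\<bar>) f g"
  proof -
    have "(form f g)\<^sup>2 = \<bar>form f g\<bar> * \<bar>form f g\<bar>"
      by (simp add: power2_eq_square)
    also have "\<dots> \<le> (form g g + \<bar>form f g\<bar>) * (form f f + \<bar>form f g\<bar>)"
      by (intro mult_mono) (auto simp: form_self_nonneg)
    finally show ?thesis
      using form_self_nonneg[of f] form_self_nonneg[of g] by (simp add: top_eigenvalue_le_def algebra_simps)
  qed
  then have "nodal_path f g \<phi> t \<in> Psphere K \<Omega>" if "t \<in> {-1..1}" for t
    using nodal_path_below(1)[OF fg \<phi> _ that] by blast
  moreover have "AE x in lebesgue. 0 \<le> \<phi> x"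
    using \<phi> by (auto simp: nonneg_minimizer_def)
  then have "AE x in lebesgue. nodal_path f g \<phi> (-1) x = - \<phi> x \<and> nodal_path f g \<phi> 1 x = \<phi> x"
    by eventually_elim (simp add: nodal_path_def tent_weight_def ramp_weight_def)
  then have "AE x in lebesgue. nodal_path f g \<phi> (-1) x = - \<phi> x" "AE x in lebesgue. nodal_path f g \<phi> 1 x = \<phi> x"
    by (simp_all add: eventually_conj_iff)
  ultimately show ?thesis
    using nodal_path_continuous[OF X0] by (simp add: Gamma_paths_def)
qed

section \<open>Strict monotonicity\<close>

lemma Gamma_paths_nonempty:
  "nonneg_minimizer K \<Omega> \<phi> \<Longrightarrow> Gamma_paths K \<Omega> \<phi> \<noteq> {}"
  using nodal_pair_exists nodal_path_Gamma by blast

lemma bdd_above_Jfun: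
  assumes "\<gamma> \<in> Gamma_paths K \<Omega> \<phi>"
  shows "bdd_above (Jfun K \<Omega> p ` \<gamma> ` {-1..1})"
proof -
  have "compact ((\<lambda>t. Jfun K \<Omega> p (\<gamma> t)) ` {-1..1})"
    by (intro compact_continuous_image continuous_on_Jfun[OF assms] compact_Icc)
  then show ?thesis
    unfolding image_image by (intro bounded_imp_bdd_above compact_imp_bounded)
qed

text \<open>
The infimum that defines \<open>minimax_level\<close> carries information only if it is taken over a set that
is nonempty and bounded below.
\<close>

lemma bdd_below_minimax:
  assumes p: "0 \<le> p"
  shows "bdd_below ((\<lambda>\<gamma>. SUP u\<in>\<gamma> ` {-1..1}. Jfun K \<Omega> p u) ` Gamma_paths K \<Omega> \<phi>)"
proof (rule bdd_belowI2)
  fix \<gamma> assume \<gamma>: "\<gamma> \<in> Gamma_paths K \<Omega> \<phi>"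
  have u: "\<gamma> 0 \<in> X0 K \<Omega>" "(\<integral>x. (\<gamma> 0 x)\<^sup>2 \<partial>lebesgue) = 1"
    using \<gamma> by (auto simp: Gamma_paths_def Psphere_iff)
  have "(\<integral>x. (max (\<gamma> 0 x) 0)\<^sup>2 \<partial>lebesgue) \<le> (\<integral>x. (\<gamma> 0 x)\<^sup>2 \<partial>lebesgue)"
    by (rule integral_mono[OF X0D(2)[OF X0_truncate(1)[OF u(1)]] X0D(2)[OF u(1)]]) (simp add: max_def)
  then have "p * (\<integral>x. (max (\<gamma> 0 x) 0)\<^sup>2 \<partial>lebesgue) \<le> p"
    using p u(2) by (simp add: mult_left_le)
  then have "- p \<le> Jfun K \<Omega> p (\<gamma> 0)"
    using form_self_nonneg[of "\<gamma> 0"] by (simp add: Jfun_eq[OF u(1)])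
  also have "\<dots> \<le> (SUP u\<in>\<gamma> ` {-1..1}. Jfun K \<Omega> p u)"
    by (rule cSUP_upper[OF _ bdd_above_Jfun[OF \<gamma>]]) auto
  finally show "- p \<le> (SUP u\<in>\<gamma> ` {-1..1}. Jfun K \<Omega> p u)" .
qed

lemma minimax_level_le:
  assumes "0 \<le> p" and \<phi>: "nonneg_minimizer K \<Omega> \<phi>" and fg: "nodal_pair f g" and lev: "top_eigenvalue_le p m f g"
  shows "minimax_level K \<Omega> \<phi> p \<le> m"
  unfolding minimax_level_def
proof (rule cINF_lower2[OF bdd_below_minimax[OF assms(1)] nodal_path_Gamma[OF fg \<phi>]])
  show "(SUP u\<in>nodal_path f g \<phi> ` {-1..1}. Jfun K \<Omega> p u) \<le> m"
    by (rule cSUP_least) (auto intro!: nodal_path_below(2)[OF fg \<phi> lev])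
qed

lemma nodal_pair_below:
  assumes p: "0 \<le> p" and \<phi>: "nonneg_minimizer K \<Omega> \<phi>" and m: "minimax_level K \<Omega> \<phi> p < m"
  obtains f g where "nodal_pair f g" "top_eigenvalue_le p m f g"
proof -
  obtain \<gamma> where \<gamma>: "\<gamma> \<in> Gamma_paths K \<Omega> \<phi>" and sup: "(SUP u\<in>\<gamma> ` {-1..1}. Jfun K \<Omega> p u) < m"
    using m cINF_less_iff[OF Gamma_paths_nonempty[OF \<phi>] bdd_below_minimax[OF p]]
    unfolding minimax_level_def by blast
  have "Jfun K \<Omega> p (\<gamma> t) < m" if "t \<in> {-1..1}" for t
    using cSUP_upper[OF _ bdd_above_Jfun[OF \<gamma>], of "\<gamma> t" p] that sup by fastforce
  then show thesis
    using nodal_pair_below_path[OF \<phi> \<gamma>] that by blast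
qed

text \<open>
Strict monotonicity for pairs, with a gain that is uniform over all pairs below a given level.
Raising the parameter lowers the first diagonal entry; lowering the parameter and raising the
level by the same amount lowers the second entry relative to the level. In both cases the
interaction makes the level drop by a further \<open>\<epsilon>\<close>.
\<close>

lemma top_eigenvalue_le_improves:
  assumes \<delta>: "0 < \<delta>"
  shows "\<exists>\<epsilon>>0. \<forall>f g p m. nodal_pair f g \<longrightarrow> top_eigenvalue_le p m f g \<longrightarrow> 0 \<le> p \<longrightarrow> p + m \<le> C \<longrightarrow>
      top_eigenvalue_le (p + \<delta>) (m - \<epsilon>) f g \<and> top_eigenvalue_le (p - \<delta>) (m + \<delta> - \<epsilon>) f g"
proof -
  obtain d where d: "0 < d" and D: "\<And>f g. nodal_pair f g \<Longrightarrow> form f f \<le> C \<Longrightarrow> form g g \<le> C \<Longrightarrow> d \<le> - form f g"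
    using coupling_lower_bound[of C] by blast
  obtain \<epsilon> where \<epsilon>: "0 < \<epsilon>" and gain: "\<And>x y. 0 \<le> x \<Longrightarrow> x \<le> max 1 C \<Longrightarrow> 0 \<le> y \<Longrightarrow> y \<le> max 1 C \<Longrightarrow>
      d\<^sup>2 \<le> x * y \<Longrightarrow> \<epsilon> \<le> \<delta> \<and> \<epsilon> \<le> y \<and> x * y \<le> (x + \<delta> - \<epsilon>) * (y - \<epsilon>)"
    using determinant_gain[OF _ _ \<delta>, of "d\<^sup>2" "max 1 C"] d by (metis less_max_iff_disj zero_less_one zero_less_power)
  have "top_eigenvalue_le (p + \<delta>) (m - \<epsilon>) f g \<and> top_eigenvalue_le (p - \<delta>) (m + \<delta> - \<epsilon>) f g"
    if fg: "nodal_pair f g" and lev: "top_eigenvalue_le p m f g" and p: "0 \<le> p" and C: "p + m \<le> C" for f g p m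
  proof -
    define x y where "x = m - (form f f - p)" and "y = m - form g g"
    have xy: "0 \<le> x" "0 \<le> y" "(form f g)\<^sup>2 \<le> x * y"
      using lev by (auto simp: top_eigenvalue_le_def x_def y_def)
    have bound: "x \<le> max 1 C" "y \<le> max 1 C" "form f f \<le> C" "form g g \<le> C"
      using C p xy form_self_nonneg[of f] form_self_nonneg[of g] by (auto simp: x_def y_def)
    have "d\<^sup>2 \<le> (- form f g)\<^sup>2"
      using d D[OF fg bound(3,4)] by (intro power_mono) auto
    then have "d\<^sup>2 \<le> x * y" "d\<^sup>2 \<le> y * x"
      using xy(3) by (simp_all add: mult.commute)
    then have 1: "\<epsilon> \<le> \<delta> \<and> \<epsilon> \<le> y \<and> x * y \<le> (x + \<delta> - \<epsilon>) * (y - \<epsilon>)"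
      and 2: "\<epsilon> \<le> \<delta> \<and> \<epsilon> \<le> x \<and> y * x \<le> (y + \<delta> - \<epsilon>) * (x - \<epsilon>)"
      using gain[of x y] gain[of y x] xy(1,2) bound(1,2) by blast+
    have gap: "m - \<epsilon> - (form f f - (p + \<delta>)) = x + \<delta> - \<epsilon>" "m - \<epsilon> - form g g = y - \<epsilon>"
      "m + \<delta> - \<epsilon> - (form f f - (p - \<delta>)) = x - \<epsilon>" "m + \<delta> - \<epsilon> - form g g = y + \<delta> - \<epsilon>"
      by (simp_all add: x_def y_def)
    have level_iff: "top_eigenvalue_le q k f g \<longleftrightarrow> 0 \<le> k - (form f f - q) \<and> 0 \<le> k - form g g \<and>
        (form f g)\<^sup>2 \<le> (k - (form f f - q)) * (k - form g g)" for q k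
      by (simp add: top_eigenvalue_le_def)
    have "(form f g)\<^sup>2 \<le> (x + \<delta> - \<epsilon>) * (y - \<epsilon>)" "(form f g)\<^sup>2 \<le> (x - \<epsilon>) * (y + \<delta> - \<epsilon>)"
      using 1 2 xy(3) by (simp_all add: mult.commute)
    then show ?thesis
      unfolding level_iff gap using 1 2 xy by simp
  qed
  with \<epsilon> show ?thesis by blast
qed

theorem minimax_level_strict:
  assumes \<phi>: "nonneg_minimizer K \<Omega> \<phi>" and p: "0 \<le> p\<^sub>1" "p\<^sub>1 < p\<^sub>2"
  shows "p\<^sub>1 + minimax_level K \<Omega> \<phi> p\<^sub>1 < p\<^sub>2 + minimax_level K \<Omega> \<phi> p\<^sub>2"
    and "minimax_level K \<Omega> \<phi> p\<^sub>2 < minimax_level K \<Omega> \<phi> p\<^sub>1"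
proof -
  let ?c = "minimax_level K \<Omega> \<phi>"
  define \<delta> where "\<delta> = p\<^sub>2 - p\<^sub>1"
  have \<delta>: "0 < \<delta>" and p2: "0 \<le> p\<^sub>2" using p by (auto simp: \<delta>_def)
  \<comment> \<open>Pairs that are nearly optimal for $p$ are improved by more than their distance to the optimum.\<close>
  have improve: "\<exists>\<epsilon>>0. \<exists>m f g. m < ?c p + \<epsilon> \<and> nodal_pair f g \<and>
      top_eigenvalue_le (p + \<delta>) (m - \<epsilon>) f g \<and> top_eigenvalue_le (p - \<delta>) (m + \<delta> - \<epsilon>) f g" if p: "0 \<le> p" for p
  proof -
    obtain \<epsilon> where \<epsilon>: "0 < \<epsilon>" and gain: "\<And>f g q m. nodal_pair f g \<Longrightarrow> top_eigenvalue_le q m f g \<Longrightarrow> 0 \<le> q \<Longrightarrow>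
        q + m \<le> p + ?c p + 1 \<Longrightarrow> top_eigenvalue_le (q + \<delta>) (m - \<epsilon>) f g \<and> top_eigenvalue_le (q - \<delta>) (m + \<delta> - \<epsilon>) f g"
      using top_eigenvalue_le_improves[OF \<delta>, of "p + ?c p + 1"] by blast
    \<comment> \<open>The gain \<open>\<epsilon>\<close> is uniform up to the level \<open>?c p + 1\<close>, so it is available before \<open>m\<close> is chosen.\<close>
    define m where "m = ?c p + min 1 (\<epsilon> / 2)"
    have m: "?c p < m" "m \<le> ?c p + 1" "m < ?c p + \<epsilon>"
      using \<epsilon> by (auto simp: m_def)
    obtain f g where fg: "nodal_pair f g" "top_eigenvalue_le p m f g"
      using nodal_pair_below[OF p \<phi> m(1)] by blast
    have "top_eigenvalue_le (p + \<delta>) (m - \<epsilon>) f g \<and> top_eigenvalue_le (p - \<delta>) (m + \<delta> - \<epsilon>) f g"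
      using gain[OF fg p] m(2) by simp
    with \<epsilon> m(3) fg(1) show ?thesis by blast
  qed
  show "?c p\<^sub>2 < ?c p\<^sub>1"
  proof -
    obtain \<epsilon> m f g where m: "m < ?c p\<^sub>1 + \<epsilon>" and fg: "nodal_pair f g" and lev: "top_eigenvalue_le (p\<^sub>1 + \<delta>) (m - \<epsilon>) f g"
      using improve[OF p(1)] by blast
    have "?c p\<^sub>2 \<le> m - \<epsilon>"
      using minimax_level_le[OF p2 \<phi> fg] lev by (simp add: \<delta>_def)
    with m show ?thesis by simp
  qed
  show "p\<^sub>1 + ?c p\<^sub>1 < p\<^sub>2 + ?c p\<^sub>2"
  proof -
    obtain \<epsilon> m f g where m: "m < ?c p\<^sub>2 + \<epsilon>" and fg: "nodal_pair f g"
      and lev: "top_eigenvalue_le (p\<^sub>2 - \<delta>) (m + \<delta> - \<epsilon>) f g"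
      using improve[OF p2] by blast
    have "?c p\<^sub>1 \<le> m + \<delta> - \<epsilon>"
      using minimax_level_le[OF p(1) \<phi> fg, of "m + \<delta> - \<epsilon>"] lev by (simp add: \<delta>_def)
    with m show ?thesis by (simp add: \<delta>_def)
  qed
qed

end

theorem lemma4p5:
  fixes s p\<^sub>1 p\<^sub>2 :: real
    and \<Omega> :: "(real^'n) set"
    and K \<phi>\<^sub>1 :: "real^'n \<Rightarrow> real"
  assumes "0 < s" and "s < 1" and "real CARD('n) > 2 * s"
    and "lipschitz_domain \<Omega>"
    and "admissible_kernel s K"
    and "nonneg_minimizer K \<Omega> \<phi>\<^sub>1"
    and "0 \<le> p\<^sub>1" and "p\<^sub>1 < p\<^sub>2"
  shows "p\<^sub>1 + minimax_level K \<Omega> \<phi>\<^sub>1 p\<^sub>1 < p\<^sub>2 + minimax_level K \<Omega> \<phi>\<^sub>1 p\<^sub>2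
       \<and> minimax_level K \<Omega> \<phi>\<^sub>1 p\<^sub>1 > minimax_level K \<Omega> \<phi>\<^sub>1 p\<^sub>2"
proof -
  obtain c where c: "0 < c"
    "\<And>x. x \<noteq> 0 \<Longrightarrow> c * norm x powr (- (real CARD('n) + 2 * s)) \<le> K x"
    using \<open>admissible_kernel s K\<close> unfolding admissible_kernel_def by blast
  interpret nonlocal_energy K \<Omega> s c
  proof
    show "c * norm x powr (- (real CARD('n) + 2 * s)) \<le> K x" if "x \<noteq> 0" for x
      by (rule c(2)[OF that])
  qed (use assms c(1) in \<open>simp_all add: lipschitz_domain_def\<close>)
  show ?thesis
    using minimax_level_strict[OF assms(6-8)] by blast
qed

end
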